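(* Let $0<\alpha<mn$, let $1<p_1,\dots,p_m<\infty$, $\frac1p=\frac1{p_1}+\cdots+\frac1{p_m}$, and let $0<p<q<\infty$. Let $\nu$ be an arbitrary weight on $\mathbb{R}^n$ and let $\vec\omega=(\omega_1,\dots,\omega_m)$ be weights on $\mathbb{R}^n$ such that, for each $i=1,\dots,m$, $\omega_i^{1-p_i'}$ satisfies the dyadic reverse doubling condition. Then the condition $$\text{(W)}\qquad \sup_{R\in\mathcal{R}} |R|^{\frac{\alpha}{n}+\frac1q-\frac1p}\left(\frac1{|R|}\int_R \nu\,dx\right)^{\frac1q}\prod_{i=1}^m\left(\frac1{|R|}\int_R \omega_i^{1-p_i'}\,dx\right)^{\frac1{p_i'}}<\infty$$ holds if and only if either of the following two inequalities holds (that is, (W) is equivalent to (1), and (W) is equivalent to (2)): (1) there is a constant $C$ such that for all $\vec f=(f_1,\dots,f_m)$, $$\|\mathcal{M}_{\mathcal{R},\alpha}(\vec f)\|_{L^{q,\infty}(\nu)}\le C\prod_{i=1}^m\|f_i\|_{L^{p_i}(\omega_i)};$$ (2) there is a constant $C$ such that for all $\vec f=(f_1,\dots,f_m)$, $$\|\mathcal{M}_{\mathcal{R},\alpha}(\vec f)\|_{L^{q}(\nu)}\le C\prod_{i=1}^m\|f_i\|_{L^{p_i}(\omega_i)}.$$ The analogous equivalences hold for the dyadic version: if $0<\alpha<mn$, $1<p_1,\dots,p_m<\infty$, $\frac1p=\frac1{p_1}+\cdots+\frac1{p_m}$, $0<p<q<\infty$, $\nu$ is an arbitrary weight on $\mathbb{R}^n$,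 and $\vec\omega=(\omega_1,\dots,\omega_m)$ are weights on $\mathbb{R}^n$ such that $\omega_i^{1-p_i'}$ satisfies the dyadic reverse doubling condition for each $i=1,\dots,m$, then the condition $$\text{(W}^d\text{)}\qquad \sup_{R\in\mathcal{DR}} |R|^{\frac{\alpha}{n}+\frac1q-\frac1p}\left(\frac1{|R|}\int_R \nu\,dx\right)^{\frac1q}\prod_{i=1}^m\left(\frac1{|R|}\int_R \omega_i^{1-p_i'}\,dx\right)^{\frac1{p_i'}}<\infty$$ is equivalent to the existence of a constant $C$ such that $\|\mathcal{M}^d_{\mathcal{R},\alpha}(\vec f)\|_{L^{q,\infty}(\nu)}\le C\prod_{i=1}^m\|f_i\|_{L^{p_i}(\omega_i)}$ for all $\vec f=(f_1,\dots,f_m)$, and is also equivalent to the existence of a constant $C$ such that $\|\mathcal{M}^d_{\mathcal{R},\alpha}(\vec f)\|_{L^{q}(\nu)}\le C\prod_{i=1}^m\|f_i\|_{L^{p_i}(\omega_i)}$ for all $\vec f=(f_1,\dots,f_m)$.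
   Context: $m,n\ge1$ are integers and $p_i'=p_i/(p_i-1)$. A weight is a nonnegative measurable function on $\mathbb{R}^n$. $\mathcal{R}$ is the family of all rectangles (products of $n$ bounded nondegenerate intervals) in $\mathbb{R}^n$ with sides parallel to the coordinate axes; $\mathcal{DR}\subset\mathcal{R}$ is the family of all dyadic rectangles, i.e. products of $n$ dyadic intervals (of possibly different lengths). For $\vec f=(f_1,\dots,f_m)$ with each $f_i$ locally integrable on $\mathbb{R}^n$, the multilinear fractional strong maximal operator is $$\mathcal{M}_{\mathcal{R},\alpha}(\vec f)(x)=\sup_{R\ni x,\,R\in\mathcal{R}}\ \prod_{i=1}^m\frac1{|R|^{1-\frac{\alpha}{mn}}}\int_R|f_i(y_i)|\,dy_i,\qquad x\in\mathbb{R}^n,$$ and its dyadic version $\mathcal{M}^d_{\mathcal{R},\alpha}$ is defined in the same way with the supremum over $R\in\mathcal{DR}$, $R\ni x$. Dyadic reverse doubling condition: a nonnegative measurable function $\sigma$ satisfies it if $\sigma$ is locally integrable on $\mathbb{R}^n$ and there is a constant $d>1$ such that $d\int_I\sigma\,dx\le\int_J\sigma\,dx$ for all $I,J\in\mathcal{DR}$ with $I\subset J$ and $|I|=\frac1{2^n}|J|$. $\|g\|_{L^{r}(\mu)}=(\int_{\mathbb{R}^n}|g|^r\mu\,dx)^{1/r}$ and $\|g\|_{L^{q,\infty}(\nu)}=\sup_{\lambda>0}\lambda\,\nu(\{x:|g(x)|>\lambda\})^{1/q}$, where $\nu(E)=\int_E\nu\,dx$. *)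

theory Defs
  imports "HOL-Analysis.Analysis"
begin

text \<open>
  Conventions. The space is \<open>real ^ 'n\<close>, so \<open>n = CARD('n) \<ge> 1\<close>, with Lebesgue measure; the
  indices \<open>1, \<dots>, m\<close> form a finite type \<open>'m\<close>, so \<open>m = CARD('m) \<ge> 1\<close>. Weights and the functions
  \<open>f\<^sub>i\<close> are real valued. Everything that may be infinite (integrals, averages, norms, the maximal
  function, and negative powers of weights) is \<open>ennreal\<close> valued, with \<open>0 * \<infinity> = 0\<close>.
\<close>

text \<open>
  Real powers on \<open>[0, \<infinity>]\<close>. In contrast to \<open>powr\<close> on the reals, a negative power of \<open>0\<close> is \<open>\<infinity>\<close>,
  and the zeroth power is always \<open>1\<close>.
\<close>

definition enn_powr :: "ennreal \<Rightarrow> real \<Rightarrow> ennreal"  (infixr "epowr" 80) where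
  "x epowr a =
    (if a = 0 then 1
     else if x = 0 then (if a > 0 then 0 else \<infinity>)
     else if x = \<infinity> then (if a > 0 then \<infinity> else 0)
     else ennreal (enn2real x powr a))"

definition conj_exp :: "real \<Rightarrow> real" where
  "conj_exp p = p / (p - 1)"

definition weight :: "(real ^ 'n \<Rightarrow> real) \<Rightarrow> bool" where
  "weight w \<longleftrightarrow> w \<in> borel_measurable lebesgue \<and> (\<forall>x. 0 \<le> w x)"

definition rectangles :: "(real ^ 'n) set set" where
  "rectangles = {R. \<exists>I :: 'n \<Rightarrow> real set.
     (\<forall>k. is_interval (I k) \<and> bounded (I k) \<and> (\<exists>a\<in>I k. \<exists>b\<in>I k. a < b)) \<and>
     R = {x. \<forall>k. x $ k \<in> I k}}"

definition dyadic_intervals :: "real set set" where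
  "dyadic_intervals = {{2 powi j * of_int k ..< 2 powi j * of_int (k + 1)} |j k. True}"

definition dyadic_rectangles :: "(real ^ 'n) set set" where
  "dyadic_rectangles = {R. \<exists>I :: 'n \<Rightarrow> real set.
     (\<forall>k. I k \<in> dyadic_intervals) \<and> R = {x. \<forall>k. x $ k \<in> I k}}"

abbreviation vol :: "(real ^ 'n) set \<Rightarrow> real" where
  "vol R \<equiv> measure lebesgue R"

definition average :: "(real ^ 'n) set \<Rightarrow> (real ^ 'n \<Rightarrow> ennreal) \<Rightarrow> ennreal" where
  "average R g = (\<integral>\<^sup>+x\<in>R. g x \<partial>lebesgue) / ennreal (vol R)"

definition locally_integrable :: "(real ^ 'n \<Rightarrow> real) \<Rightarrow> bool" where
  "locally_integrable f \<longleftrightarrow> (\<forall>K. compact K \<longrightarrow> f absolutely_integrable_on K)"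

text \<open>
  The condition is stated for \<open>[0, \<infinity>]\<close> valued \<open>\<sigma>\<close>, because it is applied to negative powers of
  weights; local integrability forces \<open>\<sigma> < \<infinity>\<close> almost everywhere.
\<close>

definition dyadic_reverse_doubling :: "(real ^ 'n \<Rightarrow> ennreal) \<Rightarrow> bool" where
  "dyadic_reverse_doubling \<sigma> \<longleftrightarrow>
     \<sigma> \<in> borel_measurable lebesgue \<and>
     (\<forall>K. compact K \<longrightarrow> (\<integral>\<^sup>+x\<in>K. \<sigma> x \<partial>lebesgue) < \<infinity>) \<and>
     (\<exists>d::real. d > 1 \<and>
       (\<forall>I \<in> dyadic_rectangles. \<forall>J \<in> dyadic_rectangles.
          I \<subseteq> J \<and> vol I = 1 / 2 ^ CARD('n) * vol J \<longrightarrow>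
          ennreal d * (\<integral>\<^sup>+x\<in>I. \<sigma> x \<partial>lebesgue) \<le> (\<integral>\<^sup>+x\<in>J. \<sigma> x \<partial>lebesgue)))"

text \<open>
  The multilinear fractional maximal operator over a family \<open>\<B>\<close> of sets:
  \<open>\<B> = rectangles\<close> gives the strong operator, \<open>\<B> = dyadic_rectangles\<close> its dyadic version.
\<close>

definition frac_max ::
    "(real ^ 'n) set set \<Rightarrow> real \<Rightarrow> ('m::finite \<Rightarrow> real ^ 'n \<Rightarrow> real) \<Rightarrow> real ^ 'n \<Rightarrow> ennreal" where
  "frac_max \<B> \<alpha> f x =
     (SUP R \<in> {R \<in> \<B>. x \<in> R}.
        \<Prod>i\<in>UNIV. (\<integral>\<^sup>+y\<in>R. ennreal \<bar>f i y\<bar> \<partial>lebesgue) /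
          ennreal (vol R powr (1 - \<alpha> / (real CARD('m) * real CARD('n)))))"

definition Lp_norm :: "real \<Rightarrow> (real ^ 'n \<Rightarrow> real) \<Rightarrow> (real ^ 'n \<Rightarrow> ennreal) \<Rightarrow> ennreal" where
  "Lp_norm r \<mu> g = (\<integral>\<^sup>+x. (g x epowr r) * ennreal (\<mu> x) \<partial>lebesgue) epowr (1 / r)"

definition weak_Lp_norm :: "real \<Rightarrow> (real ^ 'n \<Rightarrow> real) \<Rightarrow> (real ^ 'n \<Rightarrow> ennreal) \<Rightarrow> ennreal" where
  "weak_Lp_norm q \<nu> g =
     (SUP l \<in> {0::real<..}.
        ennreal l * ((\<integral>\<^sup>+x\<in>{x. g x > ennreal l}. ennreal (\<nu> x) \<partial>lebesgue) epowr (1 / q)))"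

definition weight_condition ::
    "(real ^ 'n) set set \<Rightarrow> real \<Rightarrow> ('m::finite \<Rightarrow> real) \<Rightarrow> real \<Rightarrow> real \<Rightarrow>
     (real ^ 'n \<Rightarrow> real) \<Rightarrow> ('m \<Rightarrow> real ^ 'n \<Rightarrow> real) \<Rightarrow> bool" where
  "weight_condition \<B> \<alpha> ps p q \<nu> \<omega> \<longleftrightarrow>
     (SUP R \<in> \<B>.
        ennreal (vol R powr (\<alpha> / real CARD('n) + 1 / q - 1 / p)) *
        (average R (\<lambda>x. ennreal (\<nu> x)) epowr (1 / q)) *
        (\<Prod>i\<in>UNIV. average R (\<lambda>x. ennreal (\<omega> i x) epowr (1 - conj_exp (ps i)))
                     epowr (1 / conj_exp (ps i)))) < \<infinity>"

definition weak_type_bound ::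
    "(real ^ 'n) set set \<Rightarrow> real \<Rightarrow> ('m::finite \<Rightarrow> real) \<Rightarrow> real \<Rightarrow>
     (real ^ 'n \<Rightarrow> real) \<Rightarrow> ('m \<Rightarrow> real ^ 'n \<Rightarrow> real) \<Rightarrow> bool" where
  "weak_type_bound \<B> \<alpha> ps q \<nu> \<omega> \<longleftrightarrow>
     (\<exists>C::real. \<forall>f :: 'm \<Rightarrow> real ^ 'n \<Rightarrow> real. (\<forall>i. locally_integrable (f i)) \<longrightarrow>
        weak_Lp_norm q \<nu> (frac_max \<B> \<alpha> f)
          \<le> ennreal C * (\<Prod>i\<in>UNIV. Lp_norm (ps i) (\<omega> i) (\<lambda>x. ennreal \<bar>f i x\<bar>)))"

definition strong_type_bound ::
    "(real ^ 'n) set set \<Rightarrow> real \<Rightarrow> ('m::finite \<Rightarrow> real) \<Rightarrow> real \<Rightarrow>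
     (real ^ 'n \<Rightarrow> real) \<Rightarrow> ('m \<Rightarrow> real ^ 'n \<Rightarrow> real) \<Rightarrow> bool" where
  "strong_type_bound \<B> \<alpha> ps q \<nu> \<omega> \<longleftrightarrow>
     (\<exists>C::real. \<forall>f :: 'm \<Rightarrow> real ^ 'n \<Rightarrow> real. (\<forall>i. locally_integrable (f i)) \<longrightarrow>
        Lp_norm q \<nu> (frac_max \<B> \<alpha> f)
          \<le> ennreal C * (\<Prod>i\<in>UNIV. Lp_norm (ps i) (\<omega> i) (\<lambda>x. ennreal \<bar>f i x\<bar>)))"

end

theory Submission
  imports Defs
begin

text \<open>
Write \<open>\<sigma>\<^sub>i = \<omega>\<^sub>i powr (1 - p\<^sub>i')\<close> for the dual weights and \<open>\<sigma>\<^sub>i(R)\<close> for the integral of \<open>\<sigma>\<^sub>i\<close>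
over \<open>R\<close>. Since \<open>1/p\<close> is the sum of the \<open>1/p\<^sub>i\<close>, all powers of \<open>|R|\<close> in the weight condition combine,
and it says that \<open>|R| powr (\<alpha>/n - m) * \<nu>(R) powr (1/q) * (\<Prod>i. \<sigma>\<^sub>i(R) powr (1/p\<^sub>i'))\<close> is bounded.

\<^bold>\<open>Necessity.\<close> The weak inequality for \<open>f\<^sub>i = \<sigma>\<^sub>i 1\<^sub>R\<close> gives the bound for \<open>R\<close>
(\<open>weak_type_imp_weight_condition\<close>), and the strong inequality implies the weak one by Chebyshev.

\<^bold>\<open>Sufficiency.\<close> Every rectangle that contains \<open>x\<close> lies in the triple of a dyadic rectangle that
contains \<open>x\<close> and has comparable side lengths (\<open>rectangle_in_tripled_dyadic\<close>). So the \<open>q\<close>-th power of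
either maximal function is at most a constant times the sum, over all dyadic \<open>R\<close> that contain \<open>x\<close>, of the
\<open>q\<close>-th powers of the expressions in its definition, taken for \<open>R\<close> or for its triple. After integration
against \<open>\<nu>\<close>, an application of the weight condition to each term, and Hoelder's inequality with exponents
\<open>q\<^sub>i = q p\<^sub>i / p > p\<^sub>i\<close>, one linear estimate is left for each \<open>i\<close>, the Carleson embedding
\<open>(\<Sum>R. (\<sigma>\<^sub>i(R) powr (-1/p\<^sub>i') * \<integral>\<^sub>R |f|) powr q\<^sub>i) \<le> C * (\<integral> |f| powr p\<^sub>i * \<omega>\<^sub>i) powr (q\<^sub>i / p\<^sub>i)\<close>.
A triple is a union of \<open>3\<^sup>n\<close> dyadic rectangles and has at least the \<open>\<sigma>\<^sub>i\<close>-mass of each of them, so the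
embedding for triples follows from the one for dyadic rectangles (\<open>dilated_carleson\<close>); in this way
reverse doubling on the standard grid suffices.

\<^bold>\<open>The embedding.\<close> For \<open>n \<ge> 2\<close> a point may lie in infinitely many dyadic rectangles of about the same
\<open>\<sigma>\<close>-mass, and \<open>\<sigma>\<close> has no product structure, so neither stopping times nor iteration over the coordinates
are available. The dual statement, for \<open>r = p'\<close> and \<open>1 < \<rho> = q' < r\<close>, bounds the norm of
\<open>\<Sum>R. b R * \<sigma>(R) powr (-1/r) * 1\<^sub>R\<close> in \<open>L\<^sup>r(\<sigma>)\<close> by a constant times the norm of \<open>b\<close> in \<open>\<ell>\<^sup>\<rho>\<close>. It
suffices to treat an integer exponent \<open>N\<close>, and then the integral can be expanded over \<open>N\<close>-tuples of
rectangles. A tuple contributes the product of its values of \<open>b\<close> times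
\<open>K = \<sigma>(R\<^sub>1 \<inter> \<dots> \<inter> R\<^sub>N) / (\<Prod>j. \<sigma>(R\<^sub>j) powr (1/N))\<close>. For tuples with fixed relative shapes
the sum of these terms has two bounds: by the \<open>\<ell>\<^sup>N\<close> norm of \<open>b\<close> without any gain, because rectangles of
one shape are disjoint, and by the \<open>\<ell>\<^sup>1\<close> norm of \<open>b\<close> with the gain \<open>sup K\<close>. As \<open>\<rho>\<close> lies strictly
between \<open>1\<close> and \<open>N\<close>, interpolation keeps a positive power of \<open>K\<close> (\<open>tuple_term_bound\<close>). Reverse
doubling makes \<open>K\<close> decay exponentially in the differences of the shapes (\<open>dcell_overlap_le\<close>), so this power
is summable over all shapes (\<open>dyadic_overlap_sum\<close>).
\<close>

section \<open>Inequalities for finite sums\<close>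

lemma weighted_am_gm:
  fixes x a :: "'a \<Rightarrow> real"
  assumes fin: "finite S" and a: "\<And>i. i \<in> S \<Longrightarrow> 0 \<le> a i" "(\<Sum>i\<in>S. a i) = 1"
    and x: "\<And>i. i \<in> S \<Longrightarrow> 0 \<le> x i"
  shows "(\<Prod>i\<in>S. x i powr a i) \<le> (\<Sum>i\<in>S. a i * x i)"
proof (cases "\<exists>i\<in>S. x i = 0")
  case True
  then have "(\<Prod>i\<in>S. x i powr a i) = 0" using fin by auto
  also have "0 \<le> (\<Sum>i\<in>S. a i * x i)" using a x by (intro sum_nonneg mult_nonneg_nonneg) auto
  finally show ?thesis .
next
  case False
  then have pos: "\<And>i. i \<in> S \<Longrightarrow> 0 < x i" using x by force
  have "S \<noteq> {}" using a(2) by auto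
  have "(\<Prod>i\<in>S. x i powr a i) = exp (\<Sum>i\<in>S. a i *\<^sub>R ln (x i))"
    unfolding exp_sum[OF fin] by (intro prod.cong refl) (use pos in \<open>force simp: powr_def\<close>)
  also have "\<dots> \<le> (\<Sum>i\<in>S. a i * exp (ln (x i)))"
    using convex_on_sum[OF fin \<open>S \<noteq> {}\<close> exp_convex a(2) a(1), of "\<lambda>i. ln (x i)"] by simp
  also have "\<dots> = (\<Sum>i\<in>S. a i * x i)"
    using pos by (intro sum.cong) auto
  finally show ?thesis .
qed

lemma sum_powr_subadditive:
  fixes x :: "'a \<Rightarrow> real"
  assumes fin: "finite S" and x: "\<And>i. i \<in> S \<Longrightarrow> 0 \<le> x i" and t: "0 < t" "t \<le> 1"
  shows "(\<Sum>i\<in>S. x i) powr t \<le> (\<Sum>i\<in>S. x i powr t)"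
proof -
  define s where "s = (\<Sum>i\<in>S. x i)"
  show ?thesis
  proof (cases "s = 0")
    case True
    then show ?thesis using sum_nonneg[of S "\<lambda>i. x i powr t"] by (simp add: s_def)
  next
    case False
    then have s: "s > 0" using sum_nonneg[of S x] x by (simp add: s_def)
    have "s powr t = (\<Sum>i\<in>S. x i / s) * s powr t"
      using False by (simp add: sum_divide_distrib[symmetric] s_def)
    also have "\<dots> \<le> (\<Sum>i\<in>S. (x i / s) powr t) * s powr t"
    proof (intro mult_right_mono sum_mono)
      fix i assume i: "i \<in> S"
      have "x i / s \<le> 1" using member_le_sum[OF i, of x] x fin s by (simp add: s_def)
      then have "(x i / s) powr 1 \<le> (x i / s) powr t"
        using x[OF i] s t by (intro powr_mono') auto
      then show "x i / s \<le> (x i / s) powr t" using x[OF i] s by simp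
    qed auto
    also have "\<dots> = (\<Sum>i\<in>S. x i powr t)"
      unfolding sum_distrib_right using x s by (intro sum.cong) (auto simp: powr_divide)
    finally show ?thesis by (simp add: s_def)
  qed
qed

lemma sum_powr_le_card_powr:
  fixes x :: "'a \<Rightarrow> real"
  assumes fin: "finite S" and x: "\<And>i. i \<in> S \<Longrightarrow> 0 \<le> x i" and t: "0 < t"
  shows "(\<Sum>i\<in>S. x i) powr t \<le> real (card S) powr t * (\<Sum>i\<in>S. x i powr t)"
proof (cases "S = {}")
  case False
  define M where "M = Max (x ` S)"
  have "M \<in> x ` S" unfolding M_def using fin False by (intro Max_in) auto
  then obtain k where k: "k \<in> S" "M = x k" by auto
  have "(\<Sum>i\<in>S. x i) \<le> real (card S) * M"
    using fin by (intro sum_bounded_above) (auto simp: M_def)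
  then have "(\<Sum>i\<in>S. x i) powr t \<le> (real (card S) * M) powr t"
    using x t by (intro powr_mono2 sum_nonneg) auto
  also have "\<dots> = real (card S) powr t * x k powr t"
    using x k by (simp add: powr_mult)
  also have "\<dots> \<le> real (card S) powr t * (\<Sum>i\<in>S. x i powr t)"
    using member_le_sum[OF k(1), of "\<lambda>i. x i powr t"] fin by (intro mult_left_mono) auto
  finally show ?thesis .
qed simp

text \<open>
After normalising each factor \<open>(\<Sum>R. a i R powr r i)\<close> to \<open>1\<close> this is the weighted inequality
between geometric and arithmetic mean, applied to each \<open>R\<close>.
\<close>

lemma multilinear_Hoelder_sum:
  fixes a :: "'i \<Rightarrow> 'r \<Rightarrow> real"
  assumes fin: "finite I" "finite F" and a: "\<And>i R. i \<in> I \<Longrightarrow> R \<in> F \<Longrightarrow> 0 \<le> a i R"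
    and q: "0 < q" and r: "\<And>i. i \<in> I \<Longrightarrow> 0 < r i" and sum1: "(\<Sum>i\<in>I. q / r i) = 1"
  shows "(\<Sum>R\<in>F. \<Prod>i\<in>I. a i R powr q) \<le> (\<Prod>i\<in>I. (\<Sum>R\<in>F. a i R powr r i) powr (q / r i))"
proof -
  define X where "X i = (\<Sum>R\<in>F. a i R powr r i)" for i
  have X0: "0 \<le> X i" for i unfolding X_def by (intro sum_nonneg) auto
  show ?thesis
  proof (cases "\<exists>i\<in>I. X i = 0")
    case True
    then obtain i where i: "i \<in> I" "X i = 0" by auto
    then have "\<forall>R\<in>F. a i R powr r i = 0"
      using sum_nonneg_eq_0_iff[OF fin(2), of "\<lambda>R. a i R powr r i"] by (simp add: X_def)
    then have "\<And>R. R \<in> F \<Longrightarrow> a i R = 0" by simp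
    then have "(\<Sum>R\<in>F. \<Prod>i\<in>I. a i R powr q) = 0"
      using i fin by (intro sum.neutral ballI prod_zero bexI[of _ i]) auto
    then show ?thesis by (simp add: prod_nonneg)
  next
    case False
    then have X: "\<And>i. i \<in> I \<Longrightarrow> 0 < X i" using X0 by (metis less_eq_real_def)
    have "(\<Prod>i\<in>I. a i R powr q) \<le> (\<Sum>i\<in>I. (q / r i) * (a i R powr r i / X i)) * (\<Prod>i\<in>I. X i powr (q / r i))"
      if R: "R \<in> F" for R
    proof -
      have "(\<Prod>i\<in>I. a i R powr q) =
          (\<Prod>i\<in>I. (a i R powr r i / X i) powr (q / r i)) * (\<Prod>i\<in>I. X i powr (q / r i))"
        unfolding prod.distrib[symmetric]
      proof (intro prod.cong refl)
        fix i assume i: "i \<in> I"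
        have "(a i R powr r i / X i) powr (q / r i) = a i R powr q / X i powr (q / r i)"
          using r[OF i] X[OF i] by (simp add: powr_divide powr_powr less_imp_le)
        then show "a i R powr q = (a i R powr r i / X i) powr (q / r i) * X i powr (q / r i)"
          using X[OF i] by simp
      qed
      also have "\<dots> \<le> (\<Sum>i\<in>I. (q / r i) * (a i R powr r i / X i)) * (\<Prod>i\<in>I. X i powr (q / r i))"
        using r X q by (intro mult_right_mono weighted_am_gm fin sum1 prod_nonneg) (auto simp: less_imp_le)
      finally show ?thesis .
    qed
    then have "(\<Sum>R\<in>F. \<Prod>i\<in>I. a i R powr q)
        \<le> (\<Sum>R\<in>F. (\<Sum>i\<in>I. (q / r i) * (a i R powr r i / X i)) * (\<Prod>i\<in>I. X i powr (q / r i)))"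
      by (rule sum_mono)
    also have "\<dots> = (\<Sum>i\<in>I. \<Sum>R\<in>F. (q / r i) * (a i R powr r i / X i)) * (\<Prod>i\<in>I. X i powr (q / r i))"
      unfolding sum_distrib_right[symmetric] by (subst sum.swap) simp
    also have "(\<Sum>i\<in>I. \<Sum>R\<in>F. (q / r i) * (a i R powr r i / X i)) = (\<Sum>i\<in>I. q / r i)"
    proof (intro sum.cong refl)
      fix i assume i: "i \<in> I"
      have "(\<Sum>R\<in>F. (q / r i) * (a i R powr r i / X i)) = (q / r i) * (X i / X i)"
        unfolding X_def sum_divide_distrib sum_distrib_left ..
      then show "(\<Sum>R\<in>F. (q / r i) * (a i R powr r i / X i)) = q / r i" using X[OF i] by simp
    qed
    finally show ?thesis using sum1 by (simp add: X_def)
  qed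
qed

section \<open>Sums over overlapping sets\<close>

text \<open>
One term of the expanded \<open>N\<close>-th power, with \<open>u\<close> the measure of the intersection of sets of
measures \<open>m j\<close>. For \<open>K = u * (\<Prod>j. m j powr (-1/N))\<close>, Young's inequality with exponents \<open>\<eta>\<close> and \<open>1 - \<eta>\<close>
interpolates between the products of \<open>b j powr (\<rho>/N)\<close> and of \<open>b j powr \<rho>\<close> and puts all of \<open>K\<close>, to
the power \<open>1/\<eta> > 1\<close>, on the first one. One factor \<open>K\<close> is spent on the comparison with arithmetic means;
the surplus \<open>K powr (1/\<eta> - 1)\<close> turns into small powers of the pairwise overlaps.
\<close>

lemma tuple_term_bound:
  fixes b m :: "nat \<Rightarrow> real" and N :: nat
  assumes N: "2 \<le> N" and rho: "1 < \<rho>" "\<rho> < real N"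
    and eta: "\<eta> * (1 - 1 / real N) = 1 - 1 / \<rho>"
    and eps: "\<epsilon> = (1 / \<eta> - 1) / (real N * real (N - 1))"
    and b: "\<And>j. j < N \<Longrightarrow> 0 \<le> b j" and u: "0 \<le> u"
    and m: "\<And>j. j < N \<Longrightarrow> 0 < m j \<and> u \<le> m j"
    and w: "\<And>j l. j < N \<Longrightarrow> l < N \<Longrightarrow> j \<noteq> l \<Longrightarrow> u / m j * (u / m l) \<le> w j l"
  shows "(\<Prod>j<N. b j * m j powr (- 1 / real N)) * u
     \<le> (\<Sum>j<N. b j powr \<rho> / m j * (\<Prod>l\<in>{..<N} - {j}. w j l powr \<epsilon>) * u) + (\<Prod>j<N. b j powr \<rho>)"
proof -
  have rhs1: "0 \<le> (\<Sum>j<N. b j powr \<rho> / m j * (\<Prod>l\<in>{..<N} - {j}. w j l powr \<epsilon>) * u)"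
    using u m by (intro sum_nonneg mult_nonneg_nonneg prod_nonneg divide_nonneg_pos) auto
  have rhs2: "0 \<le> (\<Prod>j<N. b j powr \<rho>)" by (intro prod_nonneg) auto
  define B where "B = (\<Prod>j<N. b j)"
  define K where "K = u * (\<Prod>j<N. m j powr (- 1 / real N))"
  have lhs: "(\<Prod>j<N. b j * m j powr (- 1 / real N)) * u = B * K"
    unfolding B_def K_def prod.distrib by simp
  have B0: "0 \<le> B" unfolding B_def using b by (intro prod_nonneg) auto
  show ?thesis
  proof (cases "B = 0 \<or> u = 0")
    case True
    then show ?thesis unfolding lhs using rhs1 rhs2 by (auto simp: K_def)
  next
    case False
    then have B: "0 < B" and u: "0 < u" using B0 u by auto
    have mpos: "0 < m j" if "j < N" for j using m[OF that] by auto
    have K: "0 < K" unfolding K_def using u mpos by (intro mult_pos_pos prod_pos) force+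
    have N1: "0 < 1 - 1 / real N" using N by simp
    have eta': "\<eta> = (1 - 1 / \<rho>) / (1 - 1 / real N)" using eta N1 by (metis eq_divide_eq less_irrefl)
    have eta0: "0 < \<eta>" unfolding eta' using N1 rho by simp
    have eta1: "\<eta> < 1" unfolding eta' using N1 rho by (simp add: frac_less2)
    have eps0: "0 < \<epsilon>" unfolding eps using eta0 eta1 N by simp
    have e1: "\<rho> / real N * \<eta> + \<rho> * (1 - \<eta>) = 1"
    proof -
      have "\<rho> / real N * \<eta> + \<rho> * (1 - \<eta>) = \<rho> - \<rho> * (\<eta> * (1 - 1 / real N))"
        by (simp add: algebra_simps)
      also have "\<dots> = 1" unfolding eta using rho by (simp add: algebra_simps)
      finally show ?thesis .
    qed
    have KN: "K = (\<Prod>j<N. (u / m j) powr (1 / real N))"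
    proof -
      have "(\<Prod>j<N. (u / m j) powr (1 / real N)) = (\<Prod>j<N. u powr (1 / real N) * m j powr (- 1 / real N))"
      proof (intro prod.cong refl)
        fix j assume "j \<in> {..<N}"
        then show "(u / m j) powr (1 / real N) = u powr (1 / real N) * m j powr (- 1 / real N)"
          using u mpos[of j] by (simp add: powr_divide powr_minus_divide)
      qed
      also have "\<dots> = K" using u N
        by (simp add: prod.distrib K_def powr_power)
      finally show ?thesis ..
    qed
    \<comment> \<open>the power of \<open>K\<close> that is left over for decay\<close>
    define \<kappa> where "\<kappa> = 1 / \<eta> - 1"
    \<comment> \<open>\<open>K powr N\<close> is the product of the ratios \<open>u / m i \<le> 1\<close>, of which two are kept\<close>
    have pair: "K powr real N \<le> w j l" if jl: "j < N" "l < N" "j \<noteq> l" for j l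
    proof -
      have "K powr real N = (\<Prod>i<N. u / m i)"
        unfolding KN using u mpos N by (subst prod_powr_distrib) (auto simp: powr_powr less_imp_le intro!: prod.cong)
      also have "\<dots> = (u / m j) * ((u / m l) * (\<Prod>i\<in>{..<N} - {j} - {l}. u / m i))"
        using jl by (simp add: prod.remove[of _ j] prod.remove[of _ l])
      also have "\<dots> \<le> (u / m j) * ((u / m l) * 1)"
        using u m jl by (intro mult_left_mono prod_le_1) (auto simp: less_imp_le)
      also have "\<dots> \<le> w j l" using w[OF jl] by simp
      finally show ?thesis .
    qed
    have decay: "K powr \<kappa> \<le> (\<Prod>l\<in>{..<N} - {j}. w j l powr \<epsilon>)" if j: "j < N" for j
    proof -
      have "K powr \<kappa> = (\<Prod>l\<in>{..<N} - {j}. (K powr real N) powr \<epsilon>)"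
        using K N j by (simp add: powr_powr powr_power eps \<kappa>_def)
      also have "\<dots> \<le> (\<Prod>l\<in>{..<N} - {j}. w j l powr \<epsilon>)"
        using pair[OF j] eps0 by (intro prod_mono conjI powr_mono2) auto
      finally show ?thesis .
    qed
    have "B powr (\<rho> / real N) * K = (\<Prod>j<N. (b j powr \<rho> * (u / m j)) powr (1 / real N))"
      unfolding B_def KN using b u mpos
      by (subst prod_powr_distrib)
        (auto simp: prod.distrib[symmetric] powr_mult powr_powr less_imp_le divide_inverse mult.assoc[symmetric] intro!: prod.cong)
    also have "\<dots> \<le> (\<Sum>j<N. 1 / real N * (b j powr \<rho> * (u / m j)))"
      using u mpos N by (intro weighted_am_gm) (auto simp: less_imp_le)
    also have "\<dots> \<le> (\<Sum>j<N. 1 * (b j powr \<rho> * (u / m j)))"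
      using u mpos N by (intro sum_mono mult_right_mono) (auto simp: less_imp_le)
    finally have "B powr (\<rho> / real N) * K * K powr \<kappa>
        \<le> (\<Sum>j<N. 1 * (b j powr \<rho> * (u / m j))) * K powr \<kappa>"
      by (intro mult_right_mono) auto
    also have "\<dots> \<le> (\<Sum>j<N. b j powr \<rho> / m j * (\<Prod>l\<in>{..<N} - {j}. w j l powr \<epsilon>) * u)"
      unfolding sum_distrib_right
    proof (intro sum_mono)
      fix j assume "j \<in> {..<N}"
      then have j: "j < N" by simp
      have "1 * (b j powr \<rho> * (u / m j)) * K powr \<kappa> \<le> 1 * (b j powr \<rho> * (u / m j)) * (\<Prod>l\<in>{..<N} - {j}. w j l powr \<epsilon>)"
        using u mpos[OF j] by (intro mult_left_mono decay j) auto
      also have "\<dots> = b j powr \<rho> / m j * (\<Prod>l\<in>{..<N} - {j}. w j l powr \<epsilon>) * u"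
        by simp
      finally show "1 * (b j powr \<rho> * (u / m j)) * K powr \<kappa> \<le> b j powr \<rho> / m j * (\<Prod>l\<in>{..<N} - {j}. w j l powr \<epsilon>) * u" .
    qed
    finally have main: "B powr (\<rho> / real N) * K * K powr \<kappa>
        \<le> (\<Sum>j<N. b j powr \<rho> / m j * (\<Prod>l\<in>{..<N} - {j}. w j l powr \<epsilon>) * u)" .
    \<comment> \<open>the choice of \<open>\<eta>\<close> makes the powers of \<open>B\<close> on the right add up to 1\<close>
    have "B * K = (B powr (\<rho> / real N) * K powr (1 / \<eta>)) powr \<eta> * (B powr \<rho>) powr (1 - \<eta>)"
      using B K eta0 e1 by (simp add: powr_mult powr_powr powr_add[symmetric])
    also have "\<dots> \<le> \<eta> * (B powr (\<rho> / real N) * K powr (1 / \<eta>)) + (1 - \<eta>) * B powr \<rho>"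
      using eta0 eta1 B K by (intro Youngs_inequality_0) auto
    also have "\<dots> \<le> 1 * (B powr (\<rho> / real N) * K powr (1 / \<eta>)) + 1 * B powr \<rho>"
      using eta0 eta1 by (intro add_mono mult_right_mono) auto
    also have "B powr \<rho> = (\<Prod>j<N. b j powr \<rho>)"
      unfolding B_def using b by (intro prod_powr_distrib)
    also have "B powr (\<rho> / real N) * K powr (1 / \<eta>) = B powr (\<rho> / real N) * K * K powr \<kappa>"
      using K unfolding \<kappa>_def by (simp add: powr_mult_base)
    finally show ?thesis unfolding lhs using main by simp
  qed
qed

text \<open>
The product of the fractions of \<open>R\<close> and of \<open>S\<close> that their intersection fills: it lies between
\<open>0\<close> and \<open>1\<close>, and is close to \<open>1\<close> only if \<open>R\<close> and \<open>S\<close> nearly coincide.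
\<close>

definition overlap :: "'b measure \<Rightarrow> 'b set \<Rightarrow> 'b set \<Rightarrow> real" where
  "overlap M R S = measure M (R \<inter> S) / measure M R * (measure M (R \<inter> S) / measure M S)"

lemma prod_indicator_INT:
  assumes "finite J"
  shows "(\<Prod>j\<in>J. indicator (B j) x) = (indicator (\<Inter>j\<in>J. B j) x :: real)"
proof (cases "x \<in> (\<Inter>j\<in>J. B j)")
  case False
  then show ?thesis using assms by (auto intro!: prod_zero simp: indicator_def)
qed auto

text \<open>
Once the \<open>j\<close>-th set is fixed and the measures of the intersections are written as integrals, the other
indices decouple: at each point of the \<open>j\<close>-th set their sums factor into \<open>N - 1\<close> overlap sums, each of
which is at most \<open>C\<close>.
\<close>

lemma fixed_index_tuple_sum:
  fixes A :: "'i \<Rightarrow> 'b set"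
  assumes I: "finite I" and A: "\<And>i. i \<in> I \<Longrightarrow> A i \<in> fmeasurable M" and pos: "\<And>i. i \<in> I \<Longrightarrow> 0 < measure M (A i)"
    and C: "\<And>i x. i \<in> I \<Longrightarrow> x \<in> A i \<Longrightarrow> (\<Sum>k\<in>I. overlap M (A i) (A k) powr \<epsilon> * indicator (A k) x) \<le> C"
    and b: "(\<Sum>i\<in>I. b i powr \<rho>) \<le> 1" and C0: "0 \<le> C" and j: "j < N"
  shows "(\<Sum>\<phi>\<in>PiE {..<N} (\<lambda>_. I). b (\<phi> j) powr \<rho> / measure M (A (\<phi> j))
            * (\<Prod>l\<in>{..<N} - {j}. overlap M (A (\<phi> j)) (A (\<phi> l)) powr \<epsilon>)
            * measure M (\<Inter>l\<in>{..<N}. A (\<phi> l))) \<le> C ^ (N - 1)"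
proof -
  let ?\<Phi> = "PiE {..<N} (\<lambda>_. I)"
  let ?w = "\<lambda>i k. overlap M (A i) (A k) powr \<epsilon>"
  define c where "c \<phi> = b (\<phi> j) powr \<rho> / measure M (A (\<phi> j)) * (\<Prod>l\<in>{..<N} - {j}. ?w (\<phi> j) (\<phi> l))" for \<phi>
  have fm: "(\<Inter>l\<in>{..<N}. A (\<phi> l)) \<in> fmeasurable M" if "\<phi> \<in> ?\<Phi>" for \<phi>
    using that j A by (intro fmeasurable.finite_INT) (auto simp: PiE_iff)
  have fint: "integrable M (\<lambda>x. c \<phi> * indicator (\<Inter>l\<in>{..<N}. A (\<phi> l)) x)" if "\<phi> \<in> ?\<Phi>" for \<phi>
    using fm[OF that] by (intro integrable_mult_right) (auto simp: fmeasurable_def)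
  have Aint: "integrable M (\<lambda>x. d * indicator (A i) x :: real)" if "i \<in> I" for i d
    using A[OF that] by (intro integrable_mult_right) (auto simp: fmeasurable_def)
  have point: "(\<Sum>\<phi>\<in>?\<Phi>. c \<phi> * indicator (\<Inter>l\<in>{..<N}. A (\<phi> l)) x)
      \<le> (\<Sum>i\<in>I. (b i powr \<rho> / measure M (A i) * C ^ (N - 1)) * indicator (A i) x)" for x
  proof -
    define G where "G i = b i powr \<rho> / measure M (A i) * indicator (A i) x" for i
    \<comment> \<open>Spreading the dependence on \<open>\<phi> j\<close> over a sum over \<open>i\<close> makes each summand a product over the tuple.\<close>
    define v where "v i l k = (if l = j then (if k = i then G i else 0) else ?w i k * indicator (A k) x)" for i l k
    have "c \<phi> * indicator (\<Inter>l\<in>{..<N}. A (\<phi> l)) x = (\<Sum>i\<in>I. \<Prod>l<N. v i l (\<phi> l))"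
      if \<phi>: "\<phi> \<in> ?\<Phi>" for \<phi>
    proof -
      have \<phi>j: "\<phi> j \<in> I" using \<phi> j by auto
      have "c \<phi> * indicator (\<Inter>l\<in>{..<N}. A (\<phi> l)) x = c \<phi> * (\<Prod>l<N. indicator (A (\<phi> l)) x)"
        by (simp add: prod_indicator_INT)
      also have "\<dots> = G (\<phi> j) * (\<Prod>l\<in>{..<N} - {j}. ?w (\<phi> j) (\<phi> l) * indicator (A (\<phi> l)) x)"
        using j unfolding c_def G_def by (simp add: prod.remove[of _ j] prod.distrib)
      also have "\<dots> = (\<Prod>l<N. v (\<phi> j) l (\<phi> l))"
        using j unfolding v_def by (simp add: prod.remove[of _ j])
      also have "\<dots> = (\<Sum>i\<in>I. if \<phi> j = i then (\<Prod>l<N. v i l (\<phi> l)) else 0)"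
        using I \<phi>j by (simp add: sum.delta')
      also have "\<dots> = (\<Sum>i\<in>I. \<Prod>l<N. v i l (\<phi> l))"
        using j by (intro sum.cong) (auto simp: v_def intro!: prod_zero[symmetric] bexI[of _ j])
      finally show ?thesis .
    qed
    then have "(\<Sum>\<phi>\<in>?\<Phi>. c \<phi> * indicator (\<Inter>l\<in>{..<N}. A (\<phi> l)) x)
        = (\<Sum>i\<in>I. \<Sum>\<phi>\<in>?\<Phi>. \<Prod>l<N. v i l (\<phi> l))"
      by (subst sum.swap) simp
    also have "\<dots> = (\<Sum>i\<in>I. \<Prod>l<N. \<Sum>k\<in>I. v i l k)"
      using I by (subst prod_sum_PiE) auto
    also have "\<dots> = (\<Sum>i\<in>I. G i * (\<Sum>k\<in>I. ?w i k * indicator (A k) x) ^ (N - 1))"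
      using j I unfolding v_def by (intro sum.cong refl) (simp add: prod.remove[of _ j] sum.delta)
    also have "\<dots> \<le> (\<Sum>i\<in>I. G i * C ^ (N - 1))"
    proof (intro sum_mono)
      fix i assume i: "i \<in> I"
      show "G i * (\<Sum>k\<in>I. ?w i k * indicator (A k) x) ^ (N - 1) \<le> G i * C ^ (N - 1)"
      proof (cases "x \<in> A i")
        case True
        show ?thesis using C[OF i True] pos[OF i]
          by (intro mult_left_mono power_mono sum_nonneg) (auto simp: G_def)
      qed (simp add: G_def)
    qed
    finally show ?thesis by (simp add: G_def mult_ac)
  qed
  have "(\<Sum>\<phi>\<in>?\<Phi>. c \<phi> * measure M (\<Inter>l\<in>{..<N}. A (\<phi> l)))
      = (\<integral>x. (\<Sum>\<phi>\<in>?\<Phi>. c \<phi> * indicator (\<Inter>l\<in>{..<N}. A (\<phi> l)) x) \<partial>M)"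
    using fint fm by (subst Bochner_Integration.integral_sum)
      (auto intro!: sum.cong simp: fmeasurable_def Int_absorb2 sets.sets_into_space)
  also have "\<dots> \<le> (\<integral>x. (\<Sum>i\<in>I. (b i powr \<rho> / measure M (A i) * C ^ (N - 1)) * indicator (A i) x) \<partial>M)"
    by (intro integral_mono Bochner_Integration.integrable_sum fint Aint point)
  also have "\<dots> = (\<Sum>i\<in>I. (b i powr \<rho> / measure M (A i) * C ^ (N - 1)) * measure M (A i))"
    using Aint A by (subst Bochner_Integration.integral_sum)
      (auto intro!: sum.cong simp: fmeasurable_def Int_absorb2 sets.sets_into_space)
  also have "\<dots> = (\<Sum>i\<in>I. b i powr \<rho>) * C ^ (N - 1)"
    unfolding sum_distrib_right using pos by (intro sum.cong refl) force
  also have "\<dots> \<le> 1 * C ^ (N - 1)"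
    using b C0 by (intro mult_right_mono) auto
  finally show ?thesis by (simp add: c_def)
qed

lemma integral_power_of_indicator_sum:
  fixes A :: "'i \<Rightarrow> 'b set" and N :: nat
  assumes I: "finite I" and A: "\<And>i. i \<in> I \<Longrightarrow> A i \<in> fmeasurable M" and pos: "\<And>i. i \<in> I \<Longrightarrow> 0 < measure M (A i)"
    and N: "2 \<le> N" and rho: "1 < \<rho>" "\<rho> < real N"
    and eta: "\<eta> * (1 - 1 / real N) = 1 - 1 / \<rho>"
    and eps: "\<epsilon> = (1 / \<eta> - 1) / (real N * real (N - 1))"
    and C: "\<And>i x. i \<in> I \<Longrightarrow> x \<in> A i \<Longrightarrow> (\<Sum>k\<in>I. overlap M (A i) (A k) powr \<epsilon> * indicator (A k) x) \<le> C"
    and b0: "\<And>i. i \<in> I \<Longrightarrow> 0 \<le> b i" and b: "(\<Sum>i\<in>I. b i powr \<rho>) \<le> 1" and C0: "0 \<le> C"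
  shows "(\<integral>\<^sup>+x. ennreal ((\<Sum>i\<in>I. b i * measure M (A i) powr (- 1 / real N) * indicator (A i) x) ^ N) \<partial>M)
           \<le> ennreal (real N * C ^ (N - 1) + 1)"
proof -
  let ?\<Phi> = "PiE {..<N} (\<lambda>_. I)"
  let ?U = "\<lambda>\<phi>. \<Inter>l\<in>{..<N}. A (\<phi> l)"
  let ?c = "\<lambda>\<phi>. \<Prod>j<N. b (\<phi> j) * measure M (A (\<phi> j)) powr (- 1 / real N)"
  have fm: "?U \<phi> \<in> fmeasurable M" if "\<phi> \<in> ?\<Phi>" for \<phi>
    using that N A by (intro fmeasurable.finite_INT) (auto simp: PiE_iff lessThan_empty_iff)
  have fint: "integrable M (\<lambda>x. ?c \<phi> * indicator (?U \<phi>) x)" if "\<phi> \<in> ?\<Phi>" for \<phi>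
    using fm[OF that] by (intro integrable_mult_right) (auto simp: fmeasurable_def)
  have expand: "(\<Sum>i\<in>I. b i * measure M (A i) powr (- 1 / real N) * indicator (A i) x) ^ N
      = (\<Sum>\<phi>\<in>?\<Phi>. ?c \<phi> * indicator (?U \<phi>) x)" for x
  proof -
    have "(\<Sum>i\<in>I. b i * measure M (A i) powr (- 1 / real N) * indicator (A i) x) ^ N
        = (\<Prod>j<N. \<Sum>i\<in>I. b i * measure M (A i) powr (- 1 / real N) * indicator (A i) x)" by simp
    also have "\<dots> = (\<Sum>\<phi>\<in>?\<Phi>. \<Prod>j<N. b (\<phi> j) * measure M (A (\<phi> j)) powr (- 1 / real N) * indicator (A (\<phi> j)) x)"
      using I by (subst prod_sum_PiE) auto
    also have "\<dots> = (\<Sum>\<phi>\<in>?\<Phi>. ?c \<phi> * indicator (?U \<phi>) x)"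
      by (subst prod.distrib) (simp add: prod_indicator_INT)
    finally show ?thesis .
  qed
  have "(\<integral>\<^sup>+x. ennreal ((\<Sum>i\<in>I. b i * measure M (A i) powr (- 1 / real N) * indicator (A i) x) ^ N) \<partial>M)
      = ennreal (\<integral>x. (\<Sum>i\<in>I. b i * measure M (A i) powr (- 1 / real N) * indicator (A i) x) ^ N \<partial>M)"
  proof (rule nn_integral_eq_integral)
    show "integrable M (\<lambda>x. (\<Sum>i\<in>I. b i * measure M (A i) powr (- 1 / real N) * indicator (A i) x) ^ N)"
      unfolding expand by (intro Bochner_Integration.integrable_sum fint)
  qed (use b0 in \<open>auto intro!: AE_I2 zero_le_power sum_nonneg\<close>)
  also have "(\<integral>x. (\<Sum>i\<in>I. b i * measure M (A i) powr (- 1 / real N) * indicator (A i) x) ^ N \<partial>M)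
      = (\<Sum>\<phi>\<in>?\<Phi>. ?c \<phi> * measure M (?U \<phi>))"
    unfolding expand using fint fm by (subst Bochner_Integration.integral_sum)
      (auto intro!: sum.cong simp: fmeasurable_def Int_absorb2 sets.sets_into_space)
  also have "\<dots> \<le> (\<Sum>\<phi>\<in>?\<Phi>. (\<Sum>j<N. b (\<phi> j) powr \<rho> / measure M (A (\<phi> j))
            * (\<Prod>l\<in>{..<N} - {j}. overlap M (A (\<phi> j)) (A (\<phi> l)) powr \<epsilon>)
            * measure M (?U \<phi>)) + (\<Prod>j<N. b (\<phi> j) powr \<rho>))"
  proof (intro sum_mono tuple_term_bound[OF N rho eta eps])
    fix \<phi> assume \<phi>: "\<phi> \<in> ?\<Phi>"
    then have \<phi>I: "\<phi> j \<in> I" if "j < N" for j using that by auto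
    show "0 \<le> b (\<phi> j)" if "j < N" for j using b0 \<phi>I[OF that] .
    show "0 \<le> measure M (?U \<phi>)" by simp
    show "0 < measure M (A (\<phi> j)) \<and> measure M (?U \<phi>) \<le> measure M (A (\<phi> j))" if "j < N" for j
      using pos[OF \<phi>I[OF that]] fm[OF \<phi>] A[OF \<phi>I[OF that]] that
      by (auto intro!: measure_mono_fmeasurable)
    show "measure M (?U \<phi>) / measure M (A (\<phi> j)) * (measure M (?U \<phi>) / measure M (A (\<phi> l)))
        \<le> overlap M (A (\<phi> j)) (A (\<phi> l))" if "j < N" "l < N" for j l
    proof -
      have "A (\<phi> j) \<inter> A (\<phi> l) \<in> fmeasurable M"
        using A[OF \<phi>I[OF that(1)]] A[OF \<phi>I[OF that(2)]] by auto
      then have "measure M (?U \<phi>) \<le> measure M (A (\<phi> j) \<inter> A (\<phi> l))"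
        using fm[OF \<phi>] that by (intro measure_mono_fmeasurable) auto
      then show ?thesis unfolding overlap_def
        using pos[OF \<phi>I[OF that(1)]] pos[OF \<phi>I[OF that(2)]]
        by (intro mult_mono divide_right_mono) auto
    qed
  qed
  also have "\<dots> = (\<Sum>j<N. \<Sum>\<phi>\<in>?\<Phi>. b (\<phi> j) powr \<rho> / measure M (A (\<phi> j))
            * (\<Prod>l\<in>{..<N} - {j}. overlap M (A (\<phi> j)) (A (\<phi> l)) powr \<epsilon>)
            * measure M (?U \<phi>)) + (\<Sum>i\<in>I. b i powr \<rho>) ^ N"
    using prod_sum_PiE[of "{..<N}" "\<lambda>_. I" "\<lambda>_ i. b i powr \<rho>"] I
    by (subst sum.swap) (simp add: sum.distrib)
  also have "\<dots> \<le> (\<Sum>j<N. C ^ (N - 1)) + 1"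
    using fixed_index_tuple_sum[OF I A pos C b C0] b
    by (intro add_mono sum_mono power_le_one sum_nonneg) auto
  finally show ?thesis by (simp add: ennreal_leI)
qed

text \<open>
The dual form of the Carleson embedding. It reduces to an integer exponent \<open>N \<ge> r\<close>, because
\<open>t \<mapsto> t powr (r/N)\<close> is subadditive: replacing \<open>b\<close> by \<open>b powr (r/N)\<close> turns \<open>\<rho>\<close> into \<open>\<rho> N / r\<close>,
which still lies strictly between \<open>1\<close> and \<open>N\<close>. The constant depends on the measure and the sets only through
\<open>C\<close>.
\<close>

lemma nn_integral_powr_of_indicator_sum:
  fixes r \<rho> :: real
  assumes rho: "1 < \<rho>" "\<rho> < r"
  shows "\<exists>\<epsilon>>0. \<forall>C\<ge>0. \<exists>D\<ge>0. \<forall>(M::'b measure) A (I::'i set) b.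
      finite I \<longrightarrow> (\<forall>i\<in>I. A i \<in> fmeasurable M \<and> 0 < measure M (A i)) \<longrightarrow>
      (\<forall>i\<in>I. \<forall>x\<in>A i. (\<Sum>k\<in>I. overlap M (A i) (A k) powr \<epsilon> * indicator (A k) x) \<le> C) \<longrightarrow>
      (\<forall>i\<in>I. 0 \<le> b i) \<longrightarrow> (\<Sum>i\<in>I. b i powr \<rho>) \<le> 1 \<longrightarrow>
      (\<integral>\<^sup>+x. ennreal ((\<Sum>i\<in>I. b i * measure M (A i) powr (- 1 / r) * indicator (A i) x) powr r) \<partial>M) \<le> ennreal D"
proof -
  define N where "N = nat \<lceil>r\<rceil>"
  have N: "r \<le> real N" "2 \<le> N" unfolding N_def using rho by linarith+
  define \<rho>' where "\<rho>' = \<rho> * real N / r"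
  have r0: "0 < r" using rho by simp
  have "\<rho> * 1 \<le> \<rho> * (real N / r)" using N r0 rho by (intro mult_left_mono) auto
  then have "1 < \<rho>'" using rho unfolding \<rho>'_def times_divide_eq_right mult_1_right by linarith
  moreover have "\<rho>' < real N" using rho r0 N by (auto simp: \<rho>'_def field_simps)
  ultimately have rho': "1 < \<rho>'" "\<rho>' < real N" .
  define \<eta> where "\<eta> = (1 - 1 / \<rho>') / (1 - 1 / real N)"
  define \<epsilon> where "\<epsilon> = (1 / \<eta> - 1) / (real N * real (N - 1))"
  have N1: "0 < 1 - 1 / real N" using N by simp
  have eta: "\<eta> * (1 - 1 / real N) = 1 - 1 / \<rho>'" using N1 \<eta>_def nonzero_eq_divide_eq by (metis less_irrefl)
  have eta01: "0 < \<eta>" "\<eta> < 1" unfolding \<eta>_def using N1 rho' by (simp_all add: frac_less2)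
  have eps0: "0 < \<epsilon>" unfolding \<epsilon>_def using eta01 N by simp
  have "\<exists>D\<ge>0. \<forall>(M::'b measure) A (I::'i set) b.
      finite I \<longrightarrow> (\<forall>i\<in>I. A i \<in> fmeasurable M \<and> 0 < measure M (A i)) \<longrightarrow>
      (\<forall>i\<in>I. \<forall>x\<in>A i. (\<Sum>k\<in>I. overlap M (A i) (A k) powr \<epsilon> * indicator (A k) x) \<le> C) \<longrightarrow>
      (\<forall>i\<in>I. 0 \<le> b i) \<longrightarrow> (\<Sum>i\<in>I. b i powr \<rho>) \<le> 1 \<longrightarrow>
      (\<integral>\<^sup>+x. ennreal ((\<Sum>i\<in>I. b i * measure M (A i) powr (- 1 / r) * indicator (A i) x) powr r) \<partial>M) \<le> ennreal D"
    if C0: "0 \<le> C" for C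
  proof (intro exI[of _ "real N * C ^ (N - 1) + 1"] conjI allI impI)
    show "0 \<le> real N * C ^ (N - 1) + 1" using C0 by simp
    fix M :: "'b measure" and A and I :: "'i set" and b :: "'i \<Rightarrow> real"
    assume I: "finite I" and A: "\<forall>i\<in>I. A i \<in> fmeasurable M \<and> 0 < measure M (A i)"
      and C: "\<forall>i\<in>I. \<forall>x\<in>A i. (\<Sum>k\<in>I. overlap M (A i) (A k) powr \<epsilon> * indicator (A k) x) \<le> C"
      and b0: "\<forall>i\<in>I. 0 \<le> b i" and b: "(\<Sum>i\<in>I. b i powr \<rho>) \<le> 1"
    have pw: "z powr r = (z powr (r / real N)) ^ N" for z :: real
      using N r0 by (cases "z = 0") (auto simp: powr_power zero_power)
    have "(\<Sum>i\<in>I. b i * measure M (A i) powr (- 1 / r) * indicator (A i) x) powr r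
        \<le> (\<Sum>i\<in>I. b i powr (r / real N) * measure M (A i) powr (- 1 / real N) * indicator (A i) x) ^ N" for x
    proof -
      have "(\<Sum>i\<in>I. b i * measure M (A i) powr (- 1 / r) * indicator (A i) x) powr r
         = ((\<Sum>i\<in>I. b i * measure M (A i) powr (- 1 / r) * indicator (A i) x) powr (r / real N)) ^ N"
        by (rule pw)
      also have "\<dots> \<le> (\<Sum>i\<in>I. (b i * measure M (A i) powr (- 1 / r) * indicator (A i) x) powr (r / real N)) ^ N"
        using b0 I r0 N by (intro power_mono sum_powr_subadditive) auto
      also have "\<dots> = (\<Sum>i\<in>I. b i powr (r / real N) * measure M (A i) powr (- 1 / real N) * indicator (A i) x) ^ N"
        using b0 r0 N by (intro arg_cong[where f = "\<lambda>z. z ^ N"] sum.cong refl)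
          (auto simp: powr_mult powr_powr indicator_def)
      finally show ?thesis .
    qed
    then have "(\<integral>\<^sup>+x. ennreal ((\<Sum>i\<in>I. b i * measure M (A i) powr (- 1 / r) * indicator (A i) x) powr r) \<partial>M)
       \<le> (\<integral>\<^sup>+x. ennreal ((\<Sum>i\<in>I. b i powr (r / real N) * measure M (A i) powr (- 1 / real N) * indicator (A i) x) ^ N) \<partial>M)"
      by (intro nn_integral_mono ennreal_leI)
    also have "\<dots> \<le> ennreal (real N * C ^ (N - 1) + 1)"
    proof (rule integral_power_of_indicator_sum[OF I _ _ N(2) rho' eta \<epsilon>_def])
      show "(\<Sum>i\<in>I. (b i powr (r / real N)) powr \<rho>') \<le> 1"
        using b r0 N by (simp add: powr_powr \<rho>'_def)
    qed (use A C C0 in auto)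
    finally show "(\<integral>\<^sup>+x. ennreal ((\<Sum>i\<in>I. b i * measure M (A i) powr (- 1 / r) * indicator (A i) x) powr r) \<partial>M)
       \<le> ennreal (real N * C ^ (N - 1) + 1)" .
  qed
  then show ?thesis using eps0 by (intro exI[of _ \<epsilon>]) simp
qed

section \<open>Powers of extended nonnegative reals\<close>

lemma epowr_ennreal: "0 \<le> x \<Longrightarrow> 0 < a \<Longrightarrow> ennreal x epowr a = ennreal (x powr a)"
  by (auto simp: enn_powr_def)

lemma epowr_ennreal_pos: "0 < x \<Longrightarrow> ennreal x epowr a = ennreal (x powr a)"
  by (auto simp: enn_powr_def)

lemma epowr_top [simp]: "0 < a \<Longrightarrow> top epowr a = top"
  by (auto simp: enn_powr_def)

lemma epowr_0 [simp]: "0 < a \<Longrightarrow> 0 epowr a = 0"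
  by (auto simp: enn_powr_def)

lemma epowr_1 [simp]: "1 epowr a = 1"
  by (auto simp: enn_powr_def)

lemma epowr_mono:
  assumes "x \<le> y" "0 < a" shows "x epowr a \<le> y epowr a"
proof (cases y rule: ennreal_cases)
  case (real s)
  then obtain r where r: "0 \<le> r" "x = ennreal r"
    using assms by (metis ennreal_cases ennreal_less_top leD)
  then show ?thesis using real assms by (auto simp: epowr_ennreal intro!: ennreal_leI powr_mono2)
qed (use assms in auto)

lemma epowr_mult:
  assumes "0 < a" shows "(x * y) epowr a = x epowr a * y epowr a"
proof (cases x rule: ennreal_cases)
  case (real r)
  show ?thesis
  proof (cases y rule: ennreal_cases)
    case (real s)
    then show ?thesis using \<open>0 \<le> r\<close> \<open>x = ennreal r\<close> assms
      by (simp add: epowr_ennreal powr_mult flip: ennreal_mult)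
  next
    case top
    then show ?thesis using \<open>0 \<le> r\<close> \<open>x = ennreal r\<close> assms
      by (cases "r = 0") (auto simp: epowr_ennreal ennreal_mult_top)
  qed
next
  case top
  show ?thesis
  proof (cases y rule: ennreal_cases)
    case (real r)
    then show ?thesis using top assms
      by (cases "r = 0") (auto simp: epowr_ennreal ennreal_top_mult)
  qed (use top assms in auto)
qed

lemma epowr_epowr: "0 < a \<Longrightarrow> 0 < b \<Longrightarrow> (x epowr a) epowr b = x epowr (a * b)"
  by (cases x rule: ennreal_cases) (auto simp: epowr_ennreal powr_powr)

lemma epowr_one [simp]: "x epowr 1 = x"
  by (cases x rule: ennreal_cases) (auto simp: epowr_ennreal)

lemma epowr_prod: "0 < a \<Longrightarrow> (\<Prod>i\<in>S. x i) epowr a = (\<Prod>i\<in>S. x i epowr a)"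
  by (induction S rule: infinite_finite_induct) (auto simp: epowr_mult)

section \<open>The Carleson embedding by duality\<close>

lemma conj_exp_facts:
  assumes "1 < p"
  shows "1 < conj_exp p" "1 / p + 1 / conj_exp p = 1" "conj_exp p / p = conj_exp p - 1"
    "1 / conj_exp p = 1 - 1 / p"
  using assms by (auto simp: conj_exp_def field_simps)

text \<open>
Young's inequality for \<open>(y w\<^sup>1\<^sup>/\<^sup>p)(t w\<^sup>-\<^sup>1\<^sup>/\<^sup>p)\<close>. Where \<open>w = 0\<close> the dual weight is infinite, so the
inequality also holds there and no exceptional set has to be removed.
\<close>

lemma weighted_Young:
  assumes p: "1 < p" and nn: "0 \<le> y" "0 \<le> t" "0 \<le> w"
  shows "ennreal (y * t) \<le> ennreal (y powr p) * ennreal w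
           + ennreal (t powr conj_exp p) * (ennreal w epowr (1 - conj_exp p))"
proof (cases "w = 0")
  case True
  have "ennreal w epowr (1 - conj_exp p) = top"
    using True conj_exp_facts(1)[OF p] by (simp add: enn_powr_def)
  then show ?thesis using nn by (cases "t = 0") (auto simp: ennreal_mult_top)
next
  case False
  then have w: "0 < w" using nn by simp
  let ?r = "conj_exp p"
  note r = conj_exp_facts[OF p]
  have "y * t = (y * w powr (1 / p)) * (t * w powr (- 1 / p))"
    using w by (simp add: powr_minus field_simps)
  also have "\<dots> \<le> (y * w powr (1 / p)) powr p / p + (t * w powr (- 1 / p)) powr ?r / ?r"
    using p r nn w by (intro Youngs_inequality) auto
  also have "\<dots> \<le> (y * w powr (1 / p)) powr p / 1 + (t * w powr (- 1 / p)) powr ?r / 1"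
    using p r by (intro add_mono divide_left_mono) auto
  also have "(y * w powr (1 / p)) powr p = y powr p * w"
    using p nn w by (simp add: powr_mult powr_powr)
  also have "(t * w powr (- 1 / p)) powr ?r = t powr ?r * w powr (1 - ?r)"
    using p nn w r(3) by (simp add: powr_mult powr_powr)
  finally have "ennreal (y * t) \<le> ennreal (y powr p * w + t powr ?r * w powr (1 - ?r))"
    by (intro ennreal_leI) simp
  also have "\<dots> = ennreal (y powr p) * ennreal w + ennreal (t powr ?r) * (ennreal w epowr (1 - ?r))"
    using w by (simp add: epowr_ennreal_pos ennreal_mult)
  finally show ?thesis .
qed

text \<open>
The numbers \<open>a\<^sub>i = m\<^sub>i powr (-1/p') * \<integral>\<^sub>A\<^sub>i |f|\<close> are tested against the extremal sequence
\<open>b\<^sub>i = a\<^sub>i powr (q-1)\<close>, normalised in \<open>\<ell>\<^sup>q\<^sup>'\<close>: the pairing is the integral of \<open>|f| * h\<close> with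
\<open>h\<close> the function in the assumption on \<open>D\<close>, and \<open>weighted_Young\<close> bounds it. Young's inequality is
not homogeneous, hence the scaling by \<open>t\<close>, which is optimised at the end.
\<close>

lemma carleson_by_duality:
  fixes M :: "'b measure" and A :: "'i \<Rightarrow> 'b set" and f w :: "'b \<Rightarrow> real" and p q :: real
  defines "m \<equiv> \<lambda>i. measure (density M (\<lambda>x. ennreal (w x) epowr (1 - conj_exp p))) (A i)"
  assumes p: "1 < p" "p < q" and I: "finite I" and A: "\<And>i. i \<in> I \<Longrightarrow> A i \<in> sets M"
    and pos: "\<And>i. i \<in> I \<Longrightarrow> 0 < m i"
    and w: "\<And>x. 0 \<le> w x" "w \<in> borel_measurable M"
       "(\<lambda>x. ennreal (w x) epowr (1 - conj_exp p)) \<in> borel_measurable M"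
    and f: "f \<in> borel_measurable M"
    and fin: "\<And>i. i \<in> I \<Longrightarrow> (\<integral>\<^sup>+x\<in>A i. ennreal \<bar>f x\<bar> \<partial>M) < \<infinity>"
    and D: "0 \<le> D" "\<And>b. (\<And>i. i \<in> I \<Longrightarrow> 0 \<le> b i) \<Longrightarrow> (\<Sum>i\<in>I. b i powr (conj_exp q)) \<le> 1 \<Longrightarrow>
      (\<integral>\<^sup>+x. ennreal ((\<Sum>i\<in>I. b i * m i powr (- 1 / conj_exp p) * indicator (A i) x) powr conj_exp p)
          \<partial>density M (\<lambda>x. ennreal (w x) epowr (1 - conj_exp p))) \<le> ennreal D"
  shows "ennreal (\<Sum>i\<in>I. (enn2real (\<integral>\<^sup>+x\<in>A i. ennreal \<bar>f x\<bar> \<partial>M) / m i powr (1 / conj_exp p)) powr q)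
      \<le> ennreal ((1 + D) powr q) * (\<integral>\<^sup>+x. (ennreal \<bar>f x\<bar> epowr p) * ennreal (w x) \<partial>M) epowr (q / p)"
proof -
  let ?r = "conj_exp p" and ?\<rho> = "conj_exp q"
  note r = conj_exp_facts[OF p(1)]
  have q1: "1 < q" using p by simp
  note rho = conj_exp_facts[OF q1]
  define \<mu> where "\<mu> i = m i" for i
  define \<sigma> where "\<sigma> x = ennreal (w x) epowr (1 - conj_exp p)" for x
  define F where "F i = enn2real (\<integral>\<^sup>+x\<in>A i. ennreal \<bar>f x\<bar> \<partial>M)" for i
  define a where "a i = F i / \<mu> i powr (1 / ?r)" for i
  define G where "G = (\<integral>\<^sup>+x. (ennreal \<bar>f x\<bar> epowr p) * ennreal (w x) \<partial>M)"
  define S where "S = (\<Sum>i\<in>I. a i powr q)"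
  have a0: "0 \<le> a i" for i by (simp add: a_def F_def)
  have mu: "0 < \<mu> i" if "i \<in> I" for i using pos[OF that] by (simp add: \<mu>_def)
  have F: "(\<integral>\<^sup>+x\<in>A i. ennreal \<bar>f x\<bar> \<partial>M) = ennreal (F i)" if "i \<in> I" for i
    using fin[OF that] by (simp add: F_def less_top)
  have S0: "0 \<le> S" unfolding S_def by (intro sum_nonneg) auto
  show ?thesis
  proof (cases "S = 0 \<or> G = top")
    case True
    then show ?thesis
    proof
      assume "S = 0"
      then show ?thesis by (simp add: S_def a_def F_def \<mu>_def)
    next
      assume "G = top"
      then have "ennreal ((1 + D) powr q) * G epowr (q / p) = top"
        using D p by (simp add: ennreal_mult_top)
      then show ?thesis by (simp add: G_def)
    qed
  next
    case False
    then have S: "0 < S" using S0 by auto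
    obtain g where g: "0 \<le> g" "G = ennreal g" using False by (cases G rule: ennreal_cases) auto
    define b where "b i = a i powr (q - 1) / S powr (1 / ?\<rho>)" for i
    have b0: "0 \<le> b i" for i by (simp add: b_def)
    have "(\<Sum>i\<in>I. b i powr ?\<rho>) = (\<Sum>i\<in>I. a i powr q / S)"
    proof (intro sum.cong refl)
      fix i
      have "(q - 1) * ?\<rho> = q" using q1 by (simp add: conj_exp_def)
      then show "b i powr ?\<rho> = a i powr q / S"
        using S rho(1) by (simp add: b_def powr_divide powr_powr)
    qed
    then have bsum: "(\<Sum>i\<in>I. b i powr ?\<rho>) = 1" using S by (simp add: S_def flip: sum_divide_distrib)
    have "(\<Sum>i\<in>I. a i * b i) = (\<Sum>i\<in>I. a i powr q) / S powr (1 / ?\<rho>)"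
      unfolding sum_divide_distrib using a0 by (intro sum.cong) (auto simp: b_def powr_mult_base)
    also have "\<dots> = S powr 1 / S powr (1 / ?\<rho>)" using S by (simp add: S_def)
    also have "\<dots> = S powr (1 / q)" unfolding powr_diff[symmetric] rho(4) by simp
    finally have absum: "(\<Sum>i\<in>I. a i * b i) = S powr (1 / q)" .
    define h where "h x = (\<Sum>i\<in>I. b i * \<mu> i powr (- 1 / ?r) * indicator (A i) x)" for x
    have h0: "0 \<le> h x" for x unfolding h_def using b0 by (intro sum_nonneg) auto
    have hm: "h \<in> borel_measurable M"
      unfolding h_def using A by (intro borel_measurable_sum) auto
    have sm: "\<sigma> \<in> borel_measurable M" using w(3) by (simp add: \<sigma>_def[abs_def])
    have "(\<integral>\<^sup>+x. ennreal (h x powr ?r) * \<sigma> x \<partial>M) = (\<integral>\<^sup>+x. ennreal (h x powr ?r) \<partial>density M \<sigma>)"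
      using sm hm by (subst nn_integral_density) (auto simp: mult.commute)
    also have "\<dots> \<le> ennreal D"
      using D(2)[of b] b0 bsum unfolding h_def \<mu>_def \<sigma>_def[abs_def] by simp
    finally have hD: "(\<integral>\<^sup>+x. ennreal (h x powr ?r) * \<sigma> x \<partial>M) \<le> ennreal D" .
    have key: "S powr (1 / q) \<le> t * (g / t powr p + D)" if t: "0 < t" for t
    proof -
      have "ennreal (S powr (1 / q) / t) = (\<Sum>i\<in>I. ennreal (b i * \<mu> i powr (- 1 / ?r) / t) * ennreal (F i))"
      proof -
        have "S powr (1 / q) / t = (\<Sum>i\<in>I. b i * \<mu> i powr (- 1 / ?r) / t * F i)"
          unfolding absum[symmetric] sum_divide_distrib a_def
          by (intro sum.cong refl) (simp add: powr_minus_divide)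
        then show ?thesis using b0 t
          by (simp add: F_def flip: ennreal_mult)
      qed
      also have "\<dots> = (\<Sum>i\<in>I. ennreal (b i * \<mu> i powr (- 1 / ?r) / t) * (\<integral>\<^sup>+x\<in>A i. ennreal \<bar>f x\<bar> \<partial>M))"
        using F by simp
      also have "\<dots> = (\<integral>\<^sup>+x. (\<Sum>i\<in>I. ennreal (b i * \<mu> i powr (- 1 / ?r) / t) * (ennreal \<bar>f x\<bar> * indicator (A i) x)) \<partial>M)"
        using A f by (subst nn_integral_sum) (auto intro!: sum.cong nn_integral_cmult[symmetric])
      also have "\<dots> = (\<integral>\<^sup>+x. ennreal (\<bar>f x\<bar> / t * h x) \<partial>M)"
      proof (intro nn_integral_cong)
        fix x
        have "\<bar>f x\<bar> / t * h x = (\<Sum>i\<in>I. b i * \<mu> i powr (- 1 / ?r) / t * (\<bar>f x\<bar> * indicator (A i) x))"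
          unfolding h_def sum_distrib_left by (intro sum.cong) auto
        also have "ennreal \<dots> = (\<Sum>i\<in>I. ennreal (b i * \<mu> i powr (- 1 / ?r) / t * (\<bar>f x\<bar> * indicator (A i) x)))"
          using b0 t by (intro sum_ennreal[symmetric]) auto
        also have "\<dots> = (\<Sum>i\<in>I. ennreal (b i * \<mu> i powr (- 1 / ?r) / t) * (ennreal \<bar>f x\<bar> * indicator (A i) x))"
          using b0 t by (intro sum.cong refl) (subst ennreal_mult, auto simp: indicator_def)
        finally show "(\<Sum>i\<in>I. ennreal (b i * \<mu> i powr (- 1 / ?r) / t) * (ennreal \<bar>f x\<bar> * indicator (A i) x)) = ennreal (\<bar>f x\<bar> / t * h x)" ..
      qed
      also have "\<dots> \<le> (\<integral>\<^sup>+x. ennreal ((\<bar>f x\<bar> / t) powr p) * ennreal (w x) + ennreal (h x powr ?r) * \<sigma> x \<partial>M)"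
        unfolding \<sigma>_def using h0 t w p by (intro nn_integral_mono weighted_Young) auto
      also have "\<dots> = (\<integral>\<^sup>+x. ennreal ((\<bar>f x\<bar> / t) powr p) * ennreal (w x) \<partial>M) + (\<integral>\<^sup>+x. ennreal (h x powr ?r) * \<sigma> x \<partial>M)"
        using f w sm hm by (intro nn_integral_add) auto
      also have "(\<integral>\<^sup>+x. ennreal ((\<bar>f x\<bar> / t) powr p) * ennreal (w x) \<partial>M)
          = (\<integral>\<^sup>+x. ennreal (1 / t powr p) * ((ennreal \<bar>f x\<bar> epowr p) * ennreal (w x)) \<partial>M)"
        using t p by (intro nn_integral_cong)
          (auto simp: powr_divide epowr_ennreal mult.assoc[symmetric] simp flip: ennreal_mult)
      also have "\<dots> = ennreal (1 / t powr p) * G"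
        unfolding G_def using f w p by (intro nn_integral_cmult) (auto simp: epowr_ennreal)
      also have "\<dots> = ennreal (g / t powr p)" using g t by (simp flip: ennreal_mult)
      also have "\<dots> + (\<integral>\<^sup>+x. ennreal (h x powr ?r) * \<sigma> x \<partial>M) \<le> ennreal (g / t powr p) + ennreal D"
        using hD by (intro add_mono) auto
      also have "\<dots> = ennreal (g / t powr p + D)" using g t D by simp
      finally have "S powr (1 / q) / t \<le> g / t powr p + D"
        using g t D by (subst (asm) ennreal_le_iff) auto
      then show ?thesis using t by (simp add: field_simps)
    qed
    have Sq: "S powr (1 / q) \<le> g powr (1 / p) * (1 + D)"
    proof (cases "g = 0")
      case True
      have "S powr (1 / q) \<le> 0 + e" if "0 < e" for e
      proof -
        have "S powr (1 / q) \<le> e / (D + 1) * D" using key[of "e / (D + 1)"] True that D by simp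
        also have "\<dots> \<le> e" using that D by (simp add: field_simps)
        finally show ?thesis by simp
      qed
      then have "S powr (1 / q) \<le> 0" by (rule field_le_epsilon)
      then show ?thesis using True by simp
    next
      case False
      then have "0 < g" using g by simp
      then show ?thesis using key[of "g powr (1 / p)"] p by (simp add: powr_powr)
    qed
    have "S = (S powr (1 / q)) powr q" using S p by (simp add: powr_powr)
    also have "\<dots> \<le> (g powr (1 / p) * (1 + D)) powr q"
      using Sq p by (intro powr_mono2) auto
    also have "\<dots> = (1 + D) powr q * g powr (q / p)"
      using g D by (simp add: powr_mult powr_powr)
    finally have "ennreal S \<le> ennreal ((1 + D) powr q) * G epowr (q / p)"
      using g p by (simp add: epowr_ennreal flip: ennreal_mult)
    then show ?thesis by (simp add: S_def a_def F_def \<mu>_def G_def)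
  qed
qed

section \<open>Rectangles and dyadic boxes\<close>

lemma rectangle_bounds:
  assumes "R \<in> rectangles"
  obtains a b :: "real ^ 'n" where "\<And>k. a $ k < b $ k" "box a b \<subseteq> R" "R \<subseteq> cbox a b"
    "R \<in> sets borel"
proof -
  obtain I :: "'n \<Rightarrow> real set" where "(\<forall>k. is_interval (I k) \<and> bounded (I k) \<and> (\<exists>a\<in>I k. \<exists>b\<in>I k. a < b)) \<and>
     R = {x. \<forall>k. x $ k \<in> I k}"
    using assms unfolding rectangles_def mem_Collect_eq by (rule exE)
  then have I: "\<And>k. is_interval (I k)" "\<And>k. bounded (I k)"
    "\<And>k. \<exists>a\<in>I k. \<exists>b\<in>I k. a < b" and R: "R = {x. \<forall>k. x $ k \<in> I k}"
    by simp_all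
  have ne: "I k \<noteq> {}" for k using I(3)[of k] by auto
  have bd: "bdd_above (I k)" "bdd_below (I k)" for k
    using I(2) by (auto intro: bounded_imp_bdd_above bounded_imp_bdd_below)
  define a where "a = (\<chi> k. Inf (I k))"
  define b where "b = (\<chi> k. Sup (I k))"
  have ab: "a $ k < b $ k" for k
  proof -
    obtain s t where "s \<in> I k" "t \<in> I k" "s < t" using I(3)[of k] by blast
    then show ?thesis using cInf_lower[OF _ bd(2), of s k] cSup_upper[OF _ bd(1), of t k]
      by (simp add: a_def b_def)
  qed
  have "y \<in> I k" if y: "Inf (I k) < y" "y < Sup (I k)" for y k
  proof -
    obtain s where "s \<in> I k" "s < y" using y(1) cInf_less_iff[OF ne bd(2), of k y] by blast
    moreover obtain t where "t \<in> I k" "y < t" using y(2) less_cSup_iff[OF ne bd(1), of y k] by blast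
    ultimately show ?thesis using mem_is_interval_1_I[OF I(1)[of k], of s t y] by simp
  qed
  then have 1: "box a b \<subseteq> R" by (simp add: R subset_iff mem_box_cart a_def b_def)
  have "Inf (I k) \<le> y" "y \<le> Sup (I k)" if "y \<in> I k" for y k
    using that bd by (simp_all add: cInf_lower cSup_upper)
  then have 2: "R \<subseteq> cbox a b" by (simp add: R subset_iff mem_box_cart a_def b_def)
  have "R = (\<Inter>k. (\<lambda>x. x $ k) -` I k)" by (auto simp: R)
  moreover have "(\<lambda>x. x $ k) -` I k \<in> sets borel" for k
  proof -
    have Ik: "I k \<in> sets borel" using I(1)[of k] by (simp add: real_interval_borel_measurable)
    have "(\<lambda>x::real^'n. x $ k) \<in> borel_measurable borel" by simp
    from measurable_sets[OF this Ik] show ?thesis by simp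
  qed
  ultimately have 3: "R \<in> sets borel" by (auto intro!: sets.finite_INT)
  show ?thesis by (intro that[OF ab 1 2 3])
qed

lemma rectangle_measure:
  fixes a b :: "real ^ 'n"
  assumes "R \<in> sets borel" "\<And>k. a $ k \<le> b $ k" "box a b \<subseteq> R" "R \<subseteq> cbox a b"
  shows "vol R = (\<Prod>k\<in>UNIV. b $ k - a $ k)"
proof -
  have R: "R \<in> lmeasurable"
    by (rule fmeasurableI2[of "cbox a b"]) (use assms in auto)
  have "cbox a b \<noteq> {}" using assms(2) by (simp add: interval_ne_empty_cart)
  then have eq: "vol (cbox a b) = (\<Prod>k\<in>UNIV. b $ k - a $ k)"
    by (simp add: content_cbox_cart)
  have "vol (box a b) \<le> vol R" "vol R \<le> vol (cbox a b)"
    using measure_mono_fmeasurable[OF assms(3) _ R] measure_mono_fmeasurable[OF assms(4)] assms(1) by auto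
  moreover have "vol (box a b) = vol (cbox a b)"
    by (simp add: measure_completion measure_lborel_box_eq measure_lborel_cbox_eq)
  ultimately show ?thesis using eq by simp
qed

lemma rectangle_measurable:
  assumes "R \<in> rectangles"
  shows "R \<in> sets lebesgue" "0 < vol R" "R \<in> lmeasurable" "\<exists>K. compact K \<and> R \<subseteq> K"
proof -
  obtain a b where ab: "\<And>k. a $ k < b $ k" "box a b \<subseteq> R" "R \<subseteq> cbox a b" "R \<in> sets borel"
    using rectangle_bounds[OF assms] by metis
  show "R \<in> sets lebesgue" using ab by auto
  have "vol R = (\<Prod>k\<in>UNIV. b $ k - a $ k)"
    using ab by (intro rectangle_measure) (auto simp: less_imp_le)
  then show "0 < vol R" using ab(1) by (simp add: prod_pos)
  show "R \<in> lmeasurable" by (rule fmeasurableI2[of "cbox a b"]) (use ab in auto)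
  show "\<exists>K. compact K \<and> R \<subseteq> K" by (intro exI[of _ "cbox a b"]) (simp add: ab(3))
qed

text \<open>
A dyadic rectangle is indexed by the exponents \<open>fst Q\<close> of its side lengths and its position \<open>snd Q\<close> in
the grid of that shape.
\<close>

definition dbox :: "('n::finite \<Rightarrow> int) \<times> ('n \<Rightarrow> int) \<Rightarrow> (real ^ 'n) set" where
  "dbox Q = {x. \<forall>i. x $ i \<in> {2 powi fst Q i * of_int (snd Q i) ..< 2 powi fst Q i * of_int (snd Q i + 1)}}"

lemma dyadic_rectangles_eq: "dyadic_rectangles = range dbox"
proof (intro equalityI subsetI)
  fix R :: "(real ^ 'n) set" assume "R \<in> dyadic_rectangles"
  then obtain I :: "'n \<Rightarrow> real set" where I: "\<And>k. I k \<in> dyadic_intervals" and R: "R = {x. \<forall>k. x $ k \<in> I k}"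
    by (auto simp: dyadic_rectangles_def)
  have "\<forall>k. \<exists>j l. I k = {2 powi j * of_int l ..< 2 powi j * of_int (l + 1)}"
    using I by (auto simp: dyadic_intervals_def)
  then obtain j l where "\<And>k. I k = {2 powi j k * of_int (l k) ..< 2 powi j k * of_int (l k + 1)}"
    by metis
  then have "R = dbox (j, l)" by (simp add: R dbox_def)
  then show "R \<in> range dbox" by blast
next
  fix R :: "(real ^ 'n) set" assume "R \<in> range dbox"
  then obtain Q where "R = dbox Q" by auto
  then show "R \<in> dyadic_rectangles"
    unfolding dyadic_rectangles_def dyadic_intervals_def dbox_def mem_Collect_eq
    by (intro exI[of _ "\<lambda>i. {2 powi fst Q i * of_int (snd Q i) ..< 2 powi fst Q i * of_int (snd Q i + 1)}"]) auto
qed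

lemma mem_dbox_iff: "x \<in> dbox Q \<longleftrightarrow> (\<forall>i. \<lfloor>x $ i / 2 powi fst Q i\<rfloor> = snd Q i)"
proof -
  have "x $ i \<in> {2 powi fst Q i * of_int (snd Q i) ..< 2 powi fst Q i * of_int (snd Q i + 1)}
     \<longleftrightarrow> \<lfloor>x $ i / 2 powi fst Q i\<rfloor> = snd Q i" for i
    by (simp add: floor_eq_iff field_simps)
  then show ?thesis by (simp add: dbox_def)
qed

text \<open>
The dyadic box around \<open>x\<close> with side lengths \<open>2 powi j i\<close>. For fixed \<open>x\<close> the dyadic boxes that
contain \<open>x\<close> correspond exactly to the shapes \<open>j\<close>.
\<close>

definition dcell :: "real ^ 'n \<Rightarrow> ('n::finite \<Rightarrow> int) \<Rightarrow> (real ^ 'n) set" where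
  "dcell x j = {y. \<forall>i. \<lfloor>y $ i / 2 powi j i\<rfloor> = \<lfloor>x $ i / 2 powi j i\<rfloor>}"

lemma dcell_eq_dbox: "dcell x j = dbox (j, \<lambda>i. \<lfloor>x $ i / 2 powi j i\<rfloor>)"
  by (simp add: set_eq_iff dcell_def mem_dbox_iff)

lemma dbox_eq_dcell: "x \<in> dbox Q \<Longrightarrow> dbox Q = dcell x (fst Q)"
  by (simp add: set_eq_iff dcell_def mem_dbox_iff)

lemma floor_coarsen:
  fixes x y :: real
  assumes "\<lfloor>x / 2 powi u\<rfloor> = \<lfloor>y / 2 powi u\<rfloor>" "u \<le> j"
  shows "\<lfloor>x / 2 powi j\<rfloor> = \<lfloor>y / 2 powi j\<rfloor>"
proof -
  define n where "n = nat (j - u)"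
  have "2 powi j = 2 powi u * (2::real) ^ n"
    using assms(2) by (simp add: n_def power_int_add[symmetric] flip: power_int_of_nat)
  then have *: "z / 2 powi j = z / 2 powi u / real_of_int (2 ^ n)" for z :: real by simp
  have "\<lfloor>z / 2 powi j\<rfloor> = \<lfloor>z / 2 powi u\<rfloor> div 2 ^ n" for z :: real
    unfolding * by (rule floor_divide_real_eq_div) simp
  then show ?thesis using assms(1) by simp
qed

lemma dcell_mono:
  fixes x :: "real ^ 'n"
  assumes "\<And>i. u i \<le> j i" shows "dcell x u \<subseteq> dcell x j"
proof
  fix y assume y: "y \<in> dcell x u"
  have "\<lfloor>y $ i / 2 powi j i\<rfloor> = \<lfloor>x $ i / 2 powi j i\<rfloor>" for i
    using floor_coarsen[of "y $ i" "u i" "x $ i" "j i"] y assms[of i] unfolding dcell_def by blast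
  then show "y \<in> dcell x j" unfolding dcell_def mem_Collect_eq by (rule allI)
qed

lemma dbox_in_rectangles: "dbox Q \<in> rectangles"
proof -
  let ?I = "\<lambda>i. {2 powi fst Q i * of_int (snd Q i) ..< 2 powi fst Q i * of_int (snd Q i + 1) :: real}"
  have "\<exists>a\<in>?I k. \<exists>b\<in>?I k. a < b" for k
  proof -
    let ?a = "2 powi fst Q k * of_int (snd Q k) :: real"
    have p: "0 < (2::real) powi fst Q k" by simp
    show ?thesis using p
      by (intro bexI[of _ ?a] bexI[of _ "?a + 2 powi fst Q k / 2"]) (auto simp: algebra_simps)
  qed
  then show ?thesis unfolding rectangles_def dbox_def
    by (auto intro!: exI[of _ ?I] simp: is_interval_co)
qed

lemma vol_dbox: "vol (dbox Q) = (\<Prod>i\<in>UNIV. 2 powi fst Q i)"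
proof -
  let ?a = "(\<chi> i. 2 powi fst Q i * of_int (snd Q i)) :: real ^ 'a" and ?b = "(\<chi> i. 2 powi fst Q i * of_int (snd Q i + 1)) :: real ^ 'a"
  have "dbox Q \<in> sets borel" using rectangle_bounds[OF dbox_in_rectangles] by metis
  then have "vol (dbox Q) = (\<Prod>k\<in>UNIV. ?b $ k - ?a $ k)"
    by (intro rectangle_measure) (auto simp: dbox_def mem_box_cart less_imp_le)
  then show ?thesis by (simp add: algebra_simps)
qed

lemma sum_geometric_int_le:
  fixes t :: real
  assumes B: "finite B" and t: "0 < t" "t < 1"
  shows "(\<Sum>l\<in>B. t ^ nat \<bar>l\<bar>) \<le> 2 / (1 - t)"
proof -
  have half: "(\<Sum>l\<in>B'. t ^ nat \<bar>l\<bar>) \<le> 1 / (1 - t)" if "B' \<subseteq> B" "inj_on (\<lambda>l. nat \<bar>l\<bar>) B'" for B'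
  proof -
    have "(\<Sum>l\<in>B'. t ^ nat \<bar>l\<bar>) = (\<Sum>n\<in>(\<lambda>l. nat \<bar>l\<bar>) ` B'. t ^ n)"
      using that by (simp add: sum.reindex)
    also have "\<dots> \<le> (\<Sum>n. t ^ n)"
      using t that B finite_subset by (intro sum_le_suminf) (auto intro!: summable_geometric)
    also have "\<dots> = 1 / (1 - t)" using t by (intro suminf_geometric) auto
    finally show ?thesis .
  qed
  have "(\<Sum>l\<in>B. t ^ nat \<bar>l\<bar>) = (\<Sum>l\<in>{l\<in>B. 0 \<le> l}. t ^ nat \<bar>l\<bar>) + (\<Sum>l\<in>{l\<in>B. l < 0}. t ^ nat \<bar>l\<bar>)"
    using B by (subst sum.union_disjoint[symmetric]) (auto intro!: sum.cong)
  also have "\<dots> \<le> 1 / (1 - t) + 1 / (1 - t)"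
    by (intro add_mono half) (auto simp: inj_on_def)
  finally show ?thesis by simp
qed

section \<open>Reverse doubling makes overlaps of dyadic boxes decay\<close>

locale dual_weight =
  fixes \<sigma> :: "real ^ 'n \<Rightarrow> ennreal"
  assumes rd: "dyadic_reverse_doubling \<sigma>" and sigma_pos: "\<And>x. 0 < \<sigma> x"
begin

lemma sigma_measurable [measurable]: "\<sigma> \<in> borel_measurable lebesgue"
  using rd by (simp add: dyadic_reverse_doubling_def)

abbreviation "\<mu> \<equiv> density lebesgue \<sigma>"

lemma emeasure_rectangle:
  assumes "R \<in> rectangles"
  shows "emeasure \<mu> R = (\<integral>\<^sup>+x\<in>R. \<sigma> x \<partial>lebesgue)" "R \<in> fmeasurable \<mu>" "0 < measure \<mu> R"
    "(\<integral>\<^sup>+x\<in>R. \<sigma> x \<partial>lebesgue) = ennreal (measure \<mu> R)"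
proof -
  note R = rectangle_measurable[OF assms]
  show 1: "emeasure \<mu> R = (\<integral>\<^sup>+x\<in>R. \<sigma> x \<partial>lebesgue)"
    using R by (simp add: emeasure_density)
  obtain K where K: "compact K" "R \<subseteq> K" using R by blast
  have "(\<integral>\<^sup>+x\<in>R. \<sigma> x \<partial>lebesgue) \<le> (\<integral>\<^sup>+x\<in>K. \<sigma> x \<partial>lebesgue)"
    using K by (intro nn_integral_mono) (auto simp: indicator_def)
  also have "\<dots> < \<infinity>" using rd K by (simp add: dyadic_reverse_doubling_def)
  finally have fin: "emeasure \<mu> R < \<infinity>" using 1 by simp
  then show 2: "R \<in> fmeasurable \<mu>" using R by (auto intro!: fmeasurableI)
  show 3: "(\<integral>\<^sup>+x\<in>R. \<sigma> x \<partial>lebesgue) = ennreal (measure \<mu> R)"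
    unfolding 1[symmetric] using fin by (intro emeasure_eq_ennreal_measure) auto
  have "emeasure \<mu> R \<noteq> 0"
  proof
    assume "emeasure \<mu> R = 0"
    then have "AE x in lebesgue. \<sigma> x * indicator R x = 0"
      using R 1 by (subst (asm) 1) (subst (asm) nn_integral_0_iff_AE, auto)
    then have "AE x in lebesgue. x \<notin> R"
      by eventually_elim (auto simp: sigma_pos[THEN less_imp_neq, symmetric])
    then have "emeasure lebesgue R = 0" using R(1) by (subst AE_iff_measurable[symmetric, where P = "\<lambda>x. x \<notin> R"]) auto
    then show False using R(2) by (simp add: measure_def)
  qed
  then show "0 < measure \<mu> R" using fin by (simp add: measure_def enn2real_positive_iff zero_less_iff_neq_zero)
qed

lemma dcell_in: "dcell x j \<in> rectangles" "dcell x j \<in> dyadic_rectangles"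
  by (auto simp: dcell_eq_dbox dbox_in_rectangles dyadic_rectangles_eq)

text \<open>
The reverse doubling condition compares any two nested dyadic boxes whose volumes differ by the factor
\<open>2\<^sup>n\<close>. Here the smaller one is obtained by halving one side \<open>n\<close> times; in this way each coordinate
can be treated separately.
\<close>

lemma iterated_reverse_doubling: "\<exists>d>1. \<forall>x j k N. d ^ N * measure \<mu> (dcell x (j(k := j k - int (CARD('n) * N)))) \<le> measure \<mu> (dcell x j)"
proof -
  have "\<exists>d::real. d > 1 \<and> (\<forall>I \<in> dyadic_rectangles. \<forall>J \<in> dyadic_rectangles.
          I \<subseteq> J \<and> vol I = 1 / 2 ^ CARD('n) * vol J \<longrightarrow>
          ennreal d * (\<integral>\<^sup>+x\<in>I. \<sigma> x \<partial>lebesgue) \<le> (\<integral>\<^sup>+x\<in>J. \<sigma> x \<partial>lebesgue))"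
    using rd unfolding dyadic_reverse_doubling_def by (elim conjE)
  then obtain d :: real where d: "d > 1" and dbl: "\<forall>I \<in> dyadic_rectangles. \<forall>J \<in> dyadic_rectangles.
          I \<subseteq> J \<and> vol I = 1 / 2 ^ CARD('n) * vol J \<longrightarrow>
          ennreal d * (\<integral>\<^sup>+x\<in>I. \<sigma> x \<partial>lebesgue) \<le> (\<integral>\<^sup>+x\<in>J. \<sigma> x \<partial>lebesgue)"
    by (elim exE conjE)
  have step: "d * measure \<mu> (dcell x (j(k := j k - int CARD('n)))) \<le> measure \<mu> (dcell x j)" for x j k
  proof -
    let ?u = "j(k := j k - int CARD('n))"
    have "vol (dcell x ?u) = 1 / 2 ^ CARD('n) * vol (dcell x j)"
    proof -
      have "vol (dcell x ?u) = 2 powi (j k - int CARD('n)) * (\<Prod>i\<in>UNIV - {k}. 2 powi j i)"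
        unfolding dcell_eq_dbox vol_dbox by (subst prod.remove[of _ k]) (auto intro!: prod.cong)
      moreover have "vol (dcell x j) = 2 powi j k * (\<Prod>i\<in>UNIV - {k}. 2 powi j i)"
        unfolding dcell_eq_dbox vol_dbox by (subst prod.remove[of _ k]) auto
      ultimately show ?thesis by (simp add: power_int_diff)
    qed
    then have "ennreal d * (\<integral>\<^sup>+x\<in>dcell x ?u. \<sigma> x \<partial>lebesgue) \<le> (\<integral>\<^sup>+x\<in>dcell x j. \<sigma> x \<partial>lebesgue)"
      by (intro dbl[rule_format] dcell_in conjI dcell_mono) auto
    then have "ennreal (d * measure \<mu> (dcell x ?u)) \<le> ennreal (measure \<mu> (dcell x j))"
      using d by (simp add: emeasure_rectangle(4)[OF dcell_in(1)] ennreal_mult)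
    then show ?thesis by (subst (asm) ennreal_le_iff) auto
  qed
  have "d ^ N * measure \<mu> (dcell x (j(k := j k - int (CARD('n) * N)))) \<le> measure \<mu> (dcell x j)" for x j k N
  proof (induction N)
    case (Suc N)
    let ?v = "j(k := j k - int (CARD('n) * N))"
    have "?v(k := ?v k - int CARD('n)) = j(k := j k - int (CARD('n) * Suc N))" by (auto simp: algebra_simps)
    with step[of x ?v k]
    have "d * measure \<mu> (dcell x (j(k := j k - int (CARD('n) * Suc N)))) \<le> measure \<mu> (dcell x ?v)" by simp
    then have "d ^ N * (d * measure \<mu> (dcell x (j(k := j k - int (CARD('n) * Suc N))))) \<le> d ^ N * measure \<mu> (dcell x ?v)"
      using d by (intro mult_left_mono) auto
    also note Suc
    finally show ?case by (simp only: power_Suc mult_ac)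
  qed simp
  then show ?thesis using d by (intro exI[of _ d]) simp
qed

lemma overlap_commute: "overlap M R S = overlap M S R"
  by (simp add: overlap_def Int_commute mult.commute)

text \<open>
In the coordinate \<open>k\<close> one of the two boxes is longer, and there the intersection is as short as the other
box. The mass of the longer box therefore drops by a factor \<open>d\<close> for every \<open>n\<close> halvings of its side; the
exponent \<open>1\<close> accounts for the remainder modulo \<open>n\<close>.
\<close>

lemma dcell_overlap_le:
  assumes d: "d > 1" and dbl: "\<And>x j k N. d ^ N * measure \<mu> (dcell x (j(k := j k - int (CARD('n) * N)))) \<le> measure \<mu> (dcell x j)"
  shows "overlap \<mu> (dcell x j) (dcell x j') \<le> d powr (1 - \<bar>real_of_int (j k - j' k)\<bar> / CARD('n))"
proof -
  have *: "overlap \<mu> (dcell x j) (dcell x j') \<le> d powr (1 - \<bar>real_of_int (j k - j' k)\<bar> / CARD('n))"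
    if le: "j' k \<le> j k" for j j'
  proof -
    define N where "N = nat ((j k - j' k) div int CARD('n))"
    have n0: "0 < int CARD('n)" by simp
    have "int CARD('n) * ((j k - j' k) div int CARD('n)) \<le> j k - j' k"
      using mult_div_mod_eq[of "int CARD('n)" "j k - j' k"] pos_mod_sign[OF n0, of "j k - j' k"] by linarith
    then have N: "int (CARD('n) * N) \<le> j k - j' k"
      using le by (simp add: N_def pos_imp_zdiv_nonneg_iff)
    have Ngt: "(j k - j' k) < int CARD('n) * (int N + 1)"
    proof -
      have "(j k - j' k) mod int CARD('n) < int CARD('n)" by simp
      then have "(j k - j' k) - int CARD('n) * ((j k - j' k) div int CARD('n)) < int CARD('n)"
        by (simp only: minus_mult_div_eq_mod)
      then show ?thesis using le by (simp add: N_def pos_imp_zdiv_nonneg_iff algebra_simps)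
    qed
    let ?R = "dcell x j" and ?S = "dcell x j'" and ?V = "dcell x (j(k := j k - int (CARD('n) * N)))"
    have fm: "dcell x u \<in> fmeasurable \<mu>" "0 < measure \<mu> (dcell x u)" for u
      using emeasure_rectangle[OF dcell_in(1)] by auto
    have sub: "?R \<inter> ?S \<subseteq> ?V"
    proof
      fix y assume y: "y \<in> ?R \<inter> ?S"
      have "\<lfloor>y $ k / 2 powi (j k - int (CARD('n) * N))\<rfloor> = \<lfloor>x $ k / 2 powi (j k - int (CARD('n) * N))\<rfloor>"
        using floor_coarsen[of "y $ k" "j' k" "x $ k"] y N unfolding dcell_def by simp
      then show "y \<in> ?V" using y unfolding dcell_def by simp
    qed
    have "measure \<mu> (?R \<inter> ?S) \<le> measure \<mu> ?V"
      using sub fm by (intro measure_mono_fmeasurable) (auto simp: fmeasurable_def)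
    also have "\<dots> \<le> measure \<mu> ?R / d ^ N" using dbl[of N x j k] d by (simp add: field_simps)
    finally have "measure \<mu> (?R \<inter> ?S) / measure \<mu> ?R \<le> 1 / d ^ N"
      using fm d by (simp add: field_simps)
    moreover have "measure \<mu> (?R \<inter> ?S) / measure \<mu> ?S \<le> 1"
      using fm by (auto intro!: measure_mono_fmeasurable simp: fmeasurable_def)
    ultimately have "overlap \<mu> ?R ?S \<le> 1 / d ^ N * 1"
      unfolding overlap_def using d by (intro mult_mono) auto
    also have "\<dots> = d powr (- real N)" using d by (simp add: powr_minus_divide powr_realpow)
    also have "\<dots> \<le> d powr (1 - \<bar>real_of_int (j k - j' k)\<bar> / CARD('n))"
    proof (intro powr_mono)
      have "real_of_int (j k - j' k) \<le> real_of_int (int CARD('n) * (int N + 1))"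
        using Ngt by (intro of_int_le_iff[THEN iffD2]) simp
      then have "real_of_int (j k - j' k) / CARD('n) \<le> real N + 1" by (simp add: field_simps)
      then show "- real N \<le> 1 - \<bar>real_of_int (j k - j' k)\<bar> / CARD('n)" using le by simp
    qed (use d in auto)
    finally show ?thesis .
  qed
  show ?thesis
  proof (cases "j' k \<le> j k")
    case False
    then show ?thesis using *[of j j'] *[of j' j] by (subst overlap_commute) (simp add: abs_minus_commute)
  qed (rule *)
qed

text \<open>
The boxes \<open>dbox P\<close> that contain \<open>x\<close> are determined by their shapes. The decay is known in each of the \<open>n\<close>
coordinates, so the overlap is at most the geometric mean of these \<open>n\<close> bounds, and the sum over
all shapes is at most a product of \<open>n\<close> geometric series over the integers.
\<close>

lemma dyadic_overlap_sum:
  assumes eps: "0 < \<epsilon>"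
  shows "\<exists>C\<ge>0. \<forall>I. finite I \<longrightarrow> (\<forall>Q\<in>I. \<forall>x\<in>dbox Q.
    (\<Sum>P\<in>I. overlap \<mu> (dbox Q) (dbox P) powr \<epsilon> * indicator (dbox P) x) \<le> C)"
proof -
  obtain d where d: "d > 1" and dbl: "\<And>x j k N. d ^ N * measure \<mu> (dcell x (j(k := j k - int (CARD('n) * N)))) \<le> measure \<mu> (dcell x j)"
    using iterated_reverse_doubling by blast
  let ?n = "real CARD('n)"
  define c where "c = d powr (\<epsilon> / ?n)"
  define t where "t = d powr (- \<epsilon> / (?n * ?n))"
  define K where "K = c * (2 / (1 - t))"
  have n: "0 < ?n" by simp
  have t: "0 < t" "t < 1"
  proof -
    have "- \<epsilon> / (?n * ?n) < 0" using eps n by (simp add: divide_neg_pos)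
    then have "d powr (- \<epsilon> / (?n * ?n)) < d powr 0" using d by (intro powr_less_mono) auto
    then show "0 < t" "t < 1" using d by (auto simp: t_def)
  qed
  have c: "0 < c" using d by (simp add: c_def)
  have K: "0 \<le> K" using t c by (simp add: K_def)
  show ?thesis
  proof (intro exI[of _ "K ^ CARD('n)"] conjI allI impI ballI)
    show "0 \<le> K ^ CARD('n)" using K by simp
    fix I :: "(('n \<Rightarrow> int) \<times> ('n \<Rightarrow> int)) set" and Q x
    assume I: "finite I" and Q: "Q \<in> I" and x: "x \<in> dbox Q"
    define J where "J = fst ` {P \<in> I. x \<in> dbox P}"
    have Jfin: "finite J" using I by (simp add: J_def)
    define B where "B = (\<Union>k. (\<lambda>j. j k) ` J)"
    have Bfin: "finite B" using Jfin by (simp add: B_def)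
    define g where "g l = c * t ^ nat \<bar>l\<bar>" for l :: int
    have g0: "0 \<le> g l" for l using c t by (simp add: g_def)
    have inj: "inj_on fst {P \<in> I. x \<in> dbox P}"
      by (auto simp: inj_on_def mem_dbox_iff prod_eq_iff fun_eq_iff)
    have "(\<Sum>P\<in>I. overlap \<mu> (dbox Q) (dbox P) powr \<epsilon> * indicator (dbox P) x)
        = (\<Sum>P\<in>{P\<in>I. x \<in> dbox P}. overlap \<mu> (dbox Q) (dbox P) powr \<epsilon>)"
      using I by (intro sum.mono_neutral_cong_right) auto
    also have "\<dots> = (\<Sum>P\<in>{P\<in>I. x \<in> dbox P}. overlap \<mu> (dcell x (fst Q)) (dcell x (fst P)) powr \<epsilon>)"
    proof (intro sum.cong refl)
      fix P assume "P \<in> {P \<in> I. x \<in> dbox P}"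
      then have "dbox P = dcell x (fst P)" by (intro dbox_eq_dcell) simp
      then show "overlap \<mu> (dbox Q) (dbox P) powr \<epsilon> = overlap \<mu> (dcell x (fst Q)) (dcell x (fst P)) powr \<epsilon>"
        by (simp add: dbox_eq_dcell[OF x])
    qed
    also have "\<dots> = (\<Sum>j\<in>J. overlap \<mu> (dcell x (fst Q)) (dcell x j) powr \<epsilon>)"
      unfolding J_def by (simp add: sum.reindex[OF inj])
    also have "\<dots> \<le> (\<Sum>j\<in>J. \<Prod>k\<in>UNIV. g (j k - fst Q k))"
    proof (intro sum_mono)
      fix j assume "j \<in> J"
      let ?o = "overlap \<mu> (dcell x (fst Q)) (dcell x j)"
      have o0: "0 \<le> ?o" by (simp add: overlap_def)
      have "?o powr \<epsilon> = (?o powr (\<epsilon> / ?n)) ^ CARD('n)"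
        using o0 eps by (cases "?o = 0") (auto simp: powr_power zero_power)
      also have "\<dots> = (\<Prod>k\<in>(UNIV::'n set). ?o powr (\<epsilon> / ?n))" by simp
      also have "\<dots> \<le> (\<Prod>k\<in>UNIV. g (j k - fst Q k))"
      proof (intro prod_mono conjI)
        fix k
        let ?a = "\<bar>real_of_int (fst Q k - j k)\<bar>"
        have "?o powr (\<epsilon> / ?n) \<le> (d powr (1 - ?a / ?n)) powr (\<epsilon> / ?n)"
          using eps n o0 dcell_overlap_le[OF d dbl, of x "fst Q" j k] by (intro powr_mono2) auto
        also have "\<dots> = d powr (\<epsilon> / ?n + (- \<epsilon> / (?n * ?n)) * ?a)"
          using n by (simp add: powr_powr field_simps)
        also have "\<dots> = c * t powr ?a"
          by (simp only: powr_add c_def t_def powr_powr)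
        also have "t powr ?a = t powr real (nat \<bar>j k - fst Q k\<bar>)"
          by (simp add: abs_minus_commute)
        also have "\<dots> = t ^ nat \<bar>j k - fst Q k\<bar>" using t by (simp only: powr_realpow)
        finally show "?o powr (\<epsilon> / ?n) \<le> g (j k - fst Q k)" by (simp add: g_def)
      qed auto
      finally show "?o powr \<epsilon> \<le> (\<Prod>k\<in>UNIV. g (j k - fst Q k))" .
    qed
    also have "\<dots> \<le> (\<Sum>j\<in>PiE UNIV (\<lambda>_. B). \<Prod>k\<in>UNIV. g (j k - fst Q k))"
      using Bfin g0 by (intro sum_mono2 prod_nonneg finite_PiE) (auto simp: B_def)
    also have "\<dots> = (\<Prod>k\<in>UNIV. \<Sum>l\<in>B. g (l - fst Q k))"
      using Bfin by (subst prod_sum_PiE) auto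
    also have "\<dots> \<le> (\<Prod>k\<in>(UNIV::'n set). K)"
    proof (intro prod_mono conjI sum_nonneg g0)
      fix k
      have "(\<Sum>l\<in>B. g (l - fst Q k)) = (\<Sum>l\<in>(\<lambda>l. l - fst Q k) ` B. g l)"
        by (subst sum.reindex) (auto simp: inj_on_def)
      also have "\<dots> = c * (\<Sum>l\<in>(\<lambda>l. l - fst Q k) ` B. t ^ nat \<bar>l\<bar>)"
        by (simp add: g_def sum_distrib_left)
      also have "\<dots> \<le> K" unfolding K_def
        using c t Bfin by (intro mult_left_mono sum_geometric_int_le) auto
      finally show "(\<Sum>l\<in>B. g (l - fst Q k)) \<le> K" .
    qed
    finally show "(\<Sum>P\<in>I. overlap \<mu> (dbox Q) (dbox P) powr \<epsilon> * indicator (dbox P) x) \<le> K ^ CARD('n)" by simp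
  qed
qed

end

section \<open>The Carleson embedding for dyadic boxes and their dilates\<close>

lemma locally_integrable_measurable:
  assumes "locally_integrable f" shows "f \<in> borel_measurable lebesgue"
proof (rule borel_measurable_LIMSEQ_real)
  show "(\<lambda>x. indicat_real (cball 0 (real n)) x *\<^sub>R f x) \<in> borel_measurable lebesgue" for n
    using assms unfolding locally_integrable_def set_integrable_def by (meson borel_measurable_integrable compact_cball)
  show "(\<lambda>n. indicat_real (cball 0 (real n)) x *\<^sub>R f x) \<longlonglongrightarrow> f x" for x
  proof (rule tendsto_eventually)
    obtain N where "norm x \<le> real N" using real_arch_simple by blast
    then show "\<forall>\<^sub>F n in sequentially. indicat_real (cball 0 (real n)) x *\<^sub>R f x = f x"
      unfolding eventually_sequentially by (intro exI[of _ N]) auto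
  qed
qed

lemma locally_integrable_finite:
  assumes "locally_integrable f" "R \<in> rectangles"
  shows "(\<integral>\<^sup>+x\<in>R. ennreal \<bar>f x\<bar> \<partial>lebesgue) < \<infinity>"
proof -
  obtain K where K: "compact K" "R \<subseteq> K" using rectangle_measurable(4)[OF assms(2)] by blast
  have "integrable lebesgue (\<lambda>x. indicat_real K x *\<^sub>R f x)"
    using assms(1) K(1) by (simp add: locally_integrable_def set_integrable_def)
  then have "(\<integral>\<^sup>+x. ennreal (norm (indicat_real K x *\<^sub>R f x)) \<partial>lebesgue) < \<infinity>"
    by (simp add: integrable_iff_bounded)
  moreover have "(\<integral>\<^sup>+x\<in>R. ennreal \<bar>f x\<bar> \<partial>lebesgue) \<le> (\<integral>\<^sup>+x. ennreal (norm (indicat_real K x *\<^sub>R f x)) \<partial>lebesgue)"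
    using K(2) by (intro nn_integral_mono) (auto simp: indicator_def)
  ultimately show ?thesis by (rule le_less_trans[rotated])
qed

lemma conj_exp_strict_antimono: "1 < p \<Longrightarrow> p < q \<Longrightarrow> conj_exp q < conj_exp p"
  by (simp add: conj_exp_def field_simps)

abbreviation (input) "dual w p \<equiv> \<lambda>x. ennreal (w x) epowr (1 - conj_exp p)"

lemma dual_weightI:
  assumes "1 < p" "dyadic_reverse_doubling (dual w p)"
  shows "dual_weight (dual w p)"
proof
  show "0 < dual w p x" for x
    using conj_exp_facts(1)[OF assms(1)] by (cases "w x \<le> 0") (auto simp: enn_powr_def ennreal_neg)
qed fact

abbreviation mass :: "(real ^ 'n \<Rightarrow> real) \<Rightarrow> real \<Rightarrow> (real ^ 'n) set \<Rightarrow> real" where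
  "mass w p R \<equiv> measure (density lebesgue (dual w p)) R"

abbreviation abs_integral :: "(real ^ 'n \<Rightarrow> real) \<Rightarrow> (real ^ 'n) set \<Rightarrow> real" where
  "abs_integral f R \<equiv> enn2real (\<integral>\<^sup>+x\<in>R. ennreal \<bar>f x\<bar> \<partial>lebesgue)"

lemma dyadic_carleson:
  fixes w :: "real ^ 'n \<Rightarrow> real"
  assumes p: "1 < p" "p < q" and w: "weight w" and rd: "dyadic_reverse_doubling (dual w p)"
  shows "\<exists>K\<ge>0. \<forall>f I. locally_integrable f \<longrightarrow> finite I \<longrightarrow>
    ennreal (\<Sum>Q\<in>I. (abs_integral f (dbox Q) / mass w p (dbox Q) powr (1 / conj_exp p)) powr q)
      \<le> ennreal K * (\<integral>\<^sup>+x. (ennreal \<bar>f x\<bar> epowr p) * ennreal (w x) \<partial>lebesgue) epowr (q / p)"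
proof -
  interpret dual_weight "dual w p" by (intro dual_weightI p rd)
  have q: "1 < q" using p by simp
  obtain \<epsilon> where eps: "0 < \<epsilon>" and *: "\<forall>C\<ge>0. \<exists>D\<ge>0. \<forall>(M::(real ^ 'n) measure) A (I::(('n \<Rightarrow> int) \<times> ('n \<Rightarrow> int)) set) b.
      finite I \<longrightarrow> (\<forall>i\<in>I. A i \<in> fmeasurable M \<and> 0 < measure M (A i)) \<longrightarrow>
      (\<forall>i\<in>I. \<forall>x\<in>A i. (\<Sum>k\<in>I. overlap M (A i) (A k) powr \<epsilon> * indicator (A k) x) \<le> C) \<longrightarrow>
      (\<forall>i\<in>I. 0 \<le> b i) \<longrightarrow> (\<Sum>i\<in>I. b i powr conj_exp q) \<le> 1 \<longrightarrow>
      (\<integral>\<^sup>+x. ennreal ((\<Sum>i\<in>I. b i * measure M (A i) powr (- 1 / conj_exp p) * indicator (A i) x) powr conj_exp p) \<partial>M) \<le> ennreal D"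
    using nn_integral_powr_of_indicator_sum[OF conj_exp_facts(1)[OF q] conj_exp_strict_antimono[OF p]] by (elim exE conjE)
  obtain C where C0: "0 \<le> C" and C: "\<forall>I. finite I \<longrightarrow> (\<forall>Q\<in>I. \<forall>x\<in>dbox Q.
    (\<Sum>P\<in>I. overlap (density lebesgue (dual w p)) (dbox Q) (dbox P) powr \<epsilon> * indicator (dbox P) x) \<le> C)"
    using dyadic_overlap_sum[OF eps] by (elim exE conjE)
  obtain D where D0: "0 \<le> D" and D: "\<forall>(M::(real ^ 'n) measure) A (I::(('n \<Rightarrow> int) \<times> ('n \<Rightarrow> int)) set) b.
      finite I \<longrightarrow> (\<forall>i\<in>I. A i \<in> fmeasurable M \<and> 0 < measure M (A i)) \<longrightarrow>
      (\<forall>i\<in>I. \<forall>x\<in>A i. (\<Sum>k\<in>I. overlap M (A i) (A k) powr \<epsilon> * indicator (A k) x) \<le> C) \<longrightarrow>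
      (\<forall>i\<in>I. 0 \<le> b i) \<longrightarrow> (\<Sum>i\<in>I. b i powr conj_exp q) \<le> 1 \<longrightarrow>
      (\<integral>\<^sup>+x. ennreal ((\<Sum>i\<in>I. b i * measure M (A i) powr (- 1 / conj_exp p) * indicator (A i) x) powr conj_exp p) \<partial>M) \<le> ennreal D"
    using *[rule_format, OF C0] by (elim exE conjE)
  show ?thesis
  proof (intro exI[of _ "(1 + D) powr q"] conjI allI impI)
    fix f :: "real ^ 'n \<Rightarrow> real" and I :: "(('n \<Rightarrow> int) \<times> ('n \<Rightarrow> int)) set"
    assume f: "locally_integrable f" and I: "finite I"
    show "ennreal (\<Sum>Q\<in>I. (abs_integral f (dbox Q) / mass w p (dbox Q) powr (1 / conj_exp p)) powr q)
      \<le> ennreal ((1 + D) powr q) * (\<integral>\<^sup>+x. (ennreal \<bar>f x\<bar> epowr p) * ennreal (w x) \<partial>lebesgue) epowr (q / p)"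
    proof (rule carleson_by_duality[OF p I _ _ _ _ _ _ _ D0])
      show "dbox Q \<in> sets lebesgue" for Q :: "('n \<Rightarrow> int) \<times> ('n \<Rightarrow> int)"
        using rectangle_measurable(1)[OF dbox_in_rectangles] .
      show "0 < mass w p (dbox Q)" for Q using emeasure_rectangle(3)[OF dbox_in_rectangles] .
      show "0 \<le> w x" for x using w by (simp add: weight_def)
      show "w \<in> borel_measurable lebesgue" using w by (simp add: weight_def)
      show "dual w p \<in> borel_measurable lebesgue" by simp
      show "f \<in> borel_measurable lebesgue" by (rule locally_integrable_measurable[OF f])
      show "(\<integral>\<^sup>+x\<in>dbox Q. ennreal \<bar>f x\<bar> \<partial>lebesgue) < \<infinity>" for Q
        by (rule locally_integrable_finite[OF f dbox_in_rectangles])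
      fix b :: "('n \<Rightarrow> int) \<times> ('n \<Rightarrow> int) \<Rightarrow> real"
      assume b: "\<And>i. i \<in> I \<Longrightarrow> 0 \<le> b i" "(\<Sum>i\<in>I. b i powr (conj_exp q)) \<le> 1"
      show "(\<integral>\<^sup>+x. ennreal ((\<Sum>i\<in>I. b i * mass w p (dbox i) powr (- 1 / conj_exp p) * indicator (dbox i) x) powr conj_exp p)
          \<partial>density lebesgue (dual w p)) \<le> ennreal D"
      proof (intro D[rule_format] I conjI)
        fix Q x assume "Q \<in> I" "x \<in> dbox Q"
        then show "(\<Sum>P\<in>I. overlap (density lebesgue (dual w p)) (dbox Q) (dbox P) powr \<epsilon> * indicator (dbox P) x) \<le> C"
          using C I by blast
      qed (use b in \<open>simp_all add: emeasure_rectangle(2,3)[OF dbox_in_rectangles]\<close>)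
    qed
  qed simp
qed

definition shift :: "('n \<Rightarrow> int) \<Rightarrow> ('n \<Rightarrow> int) \<times> ('n \<Rightarrow> int) \<Rightarrow> ('n \<Rightarrow> int) \<times> ('n \<Rightarrow> int)" where
  "shift c Q = (fst Q, \<lambda>i. snd Q i + c i)"

text \<open>
For \<open>C = {0}\<close> this is the box itself, and for \<open>C = {-1, 0, 1}\<^sup>n\<close> its triple; in this way the dyadic and the
strong maximal operator can be treated together.
\<close>

definition dilate :: "('n::finite \<Rightarrow> int) set \<Rightarrow> ('n \<Rightarrow> int) \<times> ('n \<Rightarrow> int) \<Rightarrow> (real ^ 'n) set" where
  "dilate C Q = (\<Union>c\<in>C. dbox (shift c Q))"

lemma inj_shift: "inj (shift c)"
  by (auto simp: inj_on_def shift_def prod_eq_iff fun_eq_iff)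

text \<open>
No box of the union has more mass than the union, so the normalised integral over the union is at
most the sum of those over its boxes; and each translation \<open>shift c\<close> permutes the dyadic boxes.
\<close>

lemma dilated_carleson:
  fixes w :: "real ^ 'n \<Rightarrow> real"
  assumes p: "1 < p" "p < q" and w: "weight w" and rd: "dyadic_reverse_doubling (dual w p)"
    and C: "finite C" and dilate: "\<And>Q. dilate C Q \<in> rectangles"
  shows "\<exists>K\<ge>0. \<forall>f I. locally_integrable f \<longrightarrow> finite I \<longrightarrow>
    ennreal (\<Sum>Q\<in>I. (abs_integral f (dilate C Q) / mass w p (dilate C Q) powr (1 / conj_exp p)) powr q)
      \<le> ennreal K * (\<integral>\<^sup>+x. (ennreal \<bar>f x\<bar> epowr p) * ennreal (w x) \<partial>lebesgue) epowr (q / p)"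
proof -
  interpret dual_weight "dual w p" by (intro dual_weightI p rd)
  have q: "0 < q" using p by simp
  have r: "0 < 1 / conj_exp p" using conj_exp_facts(1)[OF p(1)] by simp
  obtain K where K0: "0 \<le> K" and K: "\<forall>f I. locally_integrable f \<longrightarrow> finite I \<longrightarrow>
    ennreal (\<Sum>Q\<in>I. (abs_integral f (dbox Q) / mass w p (dbox Q) powr (1 / conj_exp p)) powr q)
      \<le> ennreal K * (\<integral>\<^sup>+x. (ennreal \<bar>f x\<bar> epowr p) * ennreal (w x) \<partial>lebesgue) epowr (q / p)"
    using dyadic_carleson[OF p w rd] by (elim exE conjE)
  let ?K = "real (card C) powr q * (real (card C) * K)"
  show ?thesis
  proof (intro exI[of _ ?K] conjI allI impI)
    show "0 \<le> ?K" using K0 by simp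
    fix f :: "real ^ 'n \<Rightarrow> real" and I :: "(('n \<Rightarrow> int) \<times> ('n \<Rightarrow> int)) set"
    assume f: "locally_integrable f" and I: "finite I"
    note fm [measurable] = locally_integrable_measurable[OF f]
    have [measurable]: "dbox Q \<in> sets lebesgue" for Q :: "('n \<Rightarrow> int) \<times> ('n \<Rightarrow> int)"
      by (rule rectangle_measurable(1)[OF dbox_in_rectangles])
    let ?G = "(\<integral>\<^sup>+x. (ennreal \<bar>f x\<bar> epowr p) * ennreal (w x) \<partial>lebesgue) epowr (q / p)"
    define a where "a R = abs_integral f R / mass w p R powr (1 / conj_exp p)" for R
    have a0: "0 \<le> a R" for R by (simp add: a_def)
    have step: "a (dilate C Q) \<le> (\<Sum>c\<in>C. a (dbox (shift c Q)))" for Q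
    proof -
      have "(\<integral>\<^sup>+x\<in>dilate C Q. ennreal \<bar>f x\<bar> \<partial>lebesgue) \<le> (\<integral>\<^sup>+x. (\<Sum>c\<in>C. ennreal \<bar>f x\<bar> * indicator (dbox (shift c Q)) x) \<partial>lebesgue)"
      proof (intro nn_integral_mono)
        fix x
        show "ennreal \<bar>f x\<bar> * indicator (dilate C Q) x \<le> (\<Sum>c\<in>C. ennreal \<bar>f x\<bar> * indicator (dbox (shift c Q)) x)"
        proof (cases "x \<in> dilate C Q")
          case True
          then obtain c where c: "c \<in> C" "x \<in> dbox (shift c Q)" by (auto simp: dilate_def)
          then show ?thesis
            using member_le_sum[of c C "\<lambda>c. ennreal \<bar>f x\<bar> * indicator (dbox (shift c Q)) x"] C True by simp
        qed simp
      qed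
      also have "\<dots> = (\<Sum>c\<in>C. \<integral>\<^sup>+x\<in>dbox (shift c Q). ennreal \<bar>f x\<bar> \<partial>lebesgue)"
        by (intro nn_integral_sum) measurable
      also have "\<dots> = (\<Sum>c\<in>C. ennreal (abs_integral f (dbox (shift c Q))))"
        using locally_integrable_finite[OF f dbox_in_rectangles] by (intro sum.cong) (auto simp: less_top)
      also have "\<dots> = ennreal (\<Sum>c\<in>C. abs_integral f (dbox (shift c Q)))" by (intro sum_ennreal) simp
      finally have F: "abs_integral f (dilate C Q) \<le> (\<Sum>c\<in>C. abs_integral f (dbox (shift c Q)))"
        by (simp add: enn2real_leI sum_nonneg)
      have "a (dilate C Q) \<le> (\<Sum>c\<in>C. abs_integral f (dbox (shift c Q)) / mass w p (dilate C Q) powr (1 / conj_exp p))"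
        unfolding a_def sum_divide_distrib[symmetric] by (intro divide_right_mono F) simp
      also have "\<dots> \<le> (\<Sum>c\<in>C. a (dbox (shift c Q)))"
        unfolding a_def
      proof (intro sum_mono divide_left_mono powr_mono2)
        fix c assume c: "c \<in> C"
        show "mass w p (dbox (shift c Q)) \<le> mass w p (dilate C Q)"
          using c by (intro measure_mono_fmeasurable fmeasurableD emeasure_rectangle(2) dbox_in_rectangles dilate) (auto simp: dilate_def)
        show "0 < mass w p (dilate C Q) powr (1 / conj_exp p) * mass w p (dbox (shift c Q)) powr (1 / conj_exp p)"
          using emeasure_rectangle(3)[OF dbox_in_rectangles, of "shift c Q"] emeasure_rectangle(3)[OF dilate, of Q] by simp
      qed (use r in auto)
      finally show ?thesis .
    qed
    have "(\<Sum>Q\<in>I. a (dilate C Q) powr q) \<le> (\<Sum>Q\<in>I. (\<Sum>c\<in>C. a (dbox (shift c Q))) powr q)"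
      using step a0 q by (intro sum_mono powr_mono2) auto
    also have "\<dots> \<le> (\<Sum>Q\<in>I. real (card C) powr q * (\<Sum>c\<in>C. a (dbox (shift c Q)) powr q))"
      using a0 q C by (intro sum_mono sum_powr_le_card_powr) auto
    also have "\<dots> = real (card C) powr q * (\<Sum>c\<in>C. \<Sum>Q\<in>I. a (dbox (shift c Q)) powr q)"
      unfolding sum_distrib_left[symmetric] by (subst sum.swap) simp
    also have "(\<Sum>c\<in>C. \<Sum>Q\<in>I. a (dbox (shift c Q)) powr q) = (\<Sum>c\<in>C. \<Sum>Q\<in>shift c ` I. a (dbox Q) powr q)"
      by (simp add: sum.reindex[OF inj_on_subset[OF inj_shift subset_UNIV]])
    finally have "ennreal (\<Sum>Q\<in>I. a (dilate C Q) powr q)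
        \<le> ennreal (real (card C) powr q) * (\<Sum>c\<in>C. ennreal (\<Sum>Q\<in>shift c ` I. a (dbox Q) powr q))"
      by (subst sum_ennreal) (auto simp: sum_nonneg ennreal_leI simp flip: ennreal_mult)
    also have "\<dots> \<le> ennreal (real (card C) powr q) * (\<Sum>c\<in>C. ennreal K * ?G)"
      unfolding a_def using I by (intro mult_left_mono sum_mono K[rule_format] f) auto
    also have "\<dots> = ennreal ?K * ?G"
      using K0 by (simp add: ennreal_mult mult_ac ennreal_of_nat_eq_real_of_nat)
    finally show "ennreal (\<Sum>Q\<in>I. (abs_integral f (dilate C Q) / mass w p (dilate C Q) powr (1 / conj_exp p)) powr q) \<le> ennreal ?K * ?G"
      by (simp add: a_def)
  qed
qed

section \<open>Weak type bounds and necessity of the weight condition\<close>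

text \<open>
The integral of an arbitrary \<open>h\<close> is the supremum over simple functions below \<open>h\<close>, so a constant can be
moved inside in this direction. This gives Chebyshev's inequality for the maximal function, a supremum over
uncountably many rectangles, without recourse to its measurability.
\<close>

lemma cmult_nn_integral_le:
  fixes h :: "'a \<Rightarrow> ennreal"
  shows "c * (\<integral>\<^sup>+x. h x \<partial>M) \<le> (\<integral>\<^sup>+x. c * h x \<partial>M)"
proof -
  have "c * (\<integral>\<^sup>+x. h x \<partial>M) = (SUP g\<in>{g. simple_function M g \<and> g \<le> h}. c * integral\<^sup>S M g)"
    unfolding nn_integral_def by (simp add: SUP_mult_left_ennreal)
  also have "\<dots> \<le> (\<integral>\<^sup>+x. c * h x \<partial>M)"
  proof (rule SUP_least)
    fix g assume "g \<in> {g. simple_function M g \<and> g \<le> h}"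
    then have g: "simple_function M g" "g \<le> h" by auto
    have "c * integral\<^sup>S M g = (\<integral>\<^sup>+x. c * g x \<partial>M)"
      using g(1) by (simp add: nn_integral_cmult borel_measurable_simple_function nn_integral_eq_simple_integral)
    also have "\<dots> \<le> (\<integral>\<^sup>+x. c * h x \<partial>M)"
      using g(2) by (intro nn_integral_mono mult_left_mono) (auto simp: le_fun_def)
    finally show "c * integral\<^sup>S M g \<le> (\<integral>\<^sup>+x. c * h x \<partial>M)" .
  qed
  finally show ?thesis .
qed

lemma weak_Lp_norm_le_Lp_norm:
  assumes q: "0 < q"
  shows "weak_Lp_norm q \<nu> g \<le> Lp_norm q \<nu> g"
  unfolding weak_Lp_norm_def
proof (rule SUP_least)
  fix l :: real assume "l \<in> {0<..}"
  then have l: "0 < l" by simp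
  have "ennreal (l powr q) * (\<integral>\<^sup>+x\<in>{x. g x > ennreal l}. ennreal (\<nu> x) \<partial>lebesgue)
      \<le> (\<integral>\<^sup>+x. ennreal (l powr q) * (ennreal (\<nu> x) * indicator {x. g x > ennreal l} x) \<partial>lebesgue)"
    by (rule cmult_nn_integral_le)
  also have "\<dots> \<le> (\<integral>\<^sup>+x. (g x epowr q) * ennreal (\<nu> x) \<partial>lebesgue)"
  proof (intro nn_integral_mono)
    fix x
    show "ennreal (l powr q) * (ennreal (\<nu> x) * indicator {x. g x > ennreal l} x) \<le> (g x epowr q) * ennreal (\<nu> x)"
    proof (cases "g x > ennreal l")
      case True
      then have "ennreal l epowr q \<le> g x epowr q" using q by (intro epowr_mono) auto
      then show ?thesis using l q True by (auto simp: epowr_ennreal intro!: mult_right_mono)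
    qed simp
  qed
  finally have "(ennreal (l powr q) * (\<integral>\<^sup>+x\<in>{x. g x > ennreal l}. ennreal (\<nu> x) \<partial>lebesgue)) epowr (1 / q) \<le> Lp_norm q \<nu> g"
    unfolding Lp_norm_def using q by (intro epowr_mono) auto
  then show "ennreal l * (\<integral>\<^sup>+x\<in>{x. g x > ennreal l}. ennreal (\<nu> x) \<partial>lebesgue) epowr (1 / q) \<le> Lp_norm q \<nu> g"
    using l q by (simp add: epowr_mult epowr_ennreal powr_powr)
qed

lemma strong_imp_weak:
  assumes "0 < q" "strong_type_bound B \<alpha> ps q \<nu> \<omega>" shows "weak_type_bound B \<alpha> ps q \<nu> \<omega>"
  using assms(2) unfolding strong_type_bound_def weak_type_bound_def
  by (meson weak_Lp_norm_le_Lp_norm[OF assms(1)] order_trans)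

locale two_weight_setting =
  fixes \<alpha> p q :: real
    and ps :: "'m::finite \<Rightarrow> real"
    and \<nu> :: "real ^ 'n \<Rightarrow> real"
    and \<omega> :: "'m \<Rightarrow> real ^ 'n \<Rightarrow> real"
  assumes alpha: "0 < \<alpha>" "\<alpha> < real CARD('m) * real CARD('n)"
    and ps: "\<And>i. 1 < ps i"
    and p_sum: "1 / p = (\<Sum>i\<in>UNIV. 1 / ps i)"
    and p: "0 < p" and pq: "p < q"
    and nu: "weight \<nu>"
    and omega: "\<And>i. weight (\<omega> i)"
    and rd: "\<And>i. dyadic_reverse_doubling (dual (\<omega> i) (ps i))"
begin

lemma dual_weight: "dual_weight (dual (\<omega> i) (ps i))"
  by (intro dual_weightI ps rd)

abbreviation "s i R \<equiv> mass (\<omega> i) (ps i) R"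

lemma s_pos: "R \<in> rectangles \<Longrightarrow> 0 < s i R"
  using dual_weight.emeasure_rectangle(3)[OF dual_weight] .

lemma s_eq: "R \<in> rectangles \<Longrightarrow> (\<integral>\<^sup>+x\<in>R. dual (\<omega> i) (ps i) x \<partial>lebesgue) = ennreal (s i R)"
  using dual_weight.emeasure_rectangle(4)[OF dual_weight] .

definition "\<beta> = 1 - \<alpha> / (real CARD('m) * real CARD('n))"

lemma beta: "0 < \<beta>"
  using alpha by (simp add: \<beta>_def)

lemma q: "0 < q" using p pq by simp

lemma exponent: "\<alpha> / real CARD('n) + 1 / q - 1 / p - 1 / q - (\<Sum>i\<in>UNIV. 1 / conj_exp (ps i)) = - (\<beta> * real CARD('m))"
proof -
  have "(\<Sum>i\<in>UNIV. 1 / conj_exp (ps i)) = (\<Sum>i\<in>UNIV. 1 - 1 / ps i)"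
    using conj_exp_facts(4)[OF ps] by simp
  also have "\<dots> = real CARD('m) - 1 / p" by (simp add: sum_subtractf p_sum)
  finally have S: "(\<Sum>i\<in>UNIV. 1 / conj_exp (ps i)) = real CARD('m) - 1 / p" .
  have "\<beta> * real CARD('m) = real CARD('m) - \<alpha> / real CARD('n)" by (simp add: \<beta>_def field_simps)
  then show ?thesis unfolding S by simp
qed

abbreviation "V R \<equiv> \<integral>\<^sup>+x\<in>R. ennreal (\<nu> x) \<partial>lebesgue"

text \<open>
The expression in the weight condition. Its three kinds of powers of the volume combine to the one in
the maximal operator, because \<open>1/p\<close> is the sum of the \<open>1/ps i\<close>.
\<close>

definition "W R = ennreal (vol R powr (- (\<beta> * real CARD('m))) * (\<Prod>i\<in>UNIV. s i R powr (1 / conj_exp (ps i)))) * V R epowr (1 / q)"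

lemma W_eq:
  assumes R: "R \<in> rectangles"
  shows "ennreal (vol R powr (\<alpha> / real CARD('n) + 1 / q - 1 / p)) *
        (average R (\<lambda>x. ennreal (\<nu> x)) epowr (1 / q)) *
        (\<Prod>i\<in>UNIV. average R (dual (\<omega> i) (ps i)) epowr (1 / conj_exp (ps i))) = W R"
proof -
  let ?v = "vol R" and ?e = "\<alpha> / real CARD('n) + 1 / q - 1 / p"
  let ?r = "\<lambda>i. 1 / conj_exp (ps i)"
  have v: "0 < ?v" by (rule rectangle_measurable(2)[OF R])
  have r: "0 < ?r i" for i using conj_exp_facts(1)[OF ps, of i] by simp
  have avg: "average R (\<lambda>x. ennreal (\<nu> x)) epowr (1 / q) = V R epowr (1 / q) * ennreal (?v powr (- 1 / q))"
  proof -
    have "average R (\<lambda>x. ennreal (\<nu> x)) = V R * ennreal (1 / ?v)"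
      using v by (simp add: average_def divide_ennreal_def inverse_ennreal divide_inverse)
    then show ?thesis using q v by (simp add: epowr_mult epowr_ennreal powr_divide powr_minus_divide)
  qed
  have "average R (dual (\<omega> i) (ps i)) epowr ?r i = ennreal (s i R powr ?r i * ?v powr (- ?r i))" for i
  proof -
    have "average R (dual (\<omega> i) (ps i)) = ennreal (s i R / ?v)"
      unfolding average_def s_eq[OF R] using v by (simp add: divide_ennreal)
    then show ?thesis using v r[of i] by (simp add: epowr_ennreal powr_divide powr_minus_divide)
  qed
  then have "(\<Prod>i\<in>UNIV. average R (dual (\<omega> i) (ps i)) epowr ?r i)
      = (\<Prod>i\<in>UNIV. ennreal (s i R powr ?r i * ?v powr (- ?r i)))" by simp
  also have "\<dots> = ennreal (\<Prod>i\<in>UNIV. s i R powr ?r i * ?v powr (- ?r i))" by (intro prod_ennreal) simp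
  also have "(\<Prod>i\<in>UNIV. s i R powr ?r i * ?v powr (- ?r i)) = (\<Prod>i\<in>UNIV. s i R powr ?r i) * ?v powr (- (\<Sum>i\<in>UNIV. ?r i))"
    using v by (simp add: prod.distrib powr_sum sum_negf[symmetric])
  finally have pr: "(\<Prod>i\<in>UNIV. average R (dual (\<omega> i) (ps i)) epowr ?r i) = ennreal \<dots>" .
  have ex: "?v powr (- (\<beta> * real CARD('m))) = ?v powr ?e * ?v powr (- 1 / q) * ?v powr (- (\<Sum>i\<in>UNIV. ?r i))"
    by (simp add: exponent[symmetric] powr_add[symmetric])
  show ?thesis unfolding avg pr W_def ex
    by (simp add: ennreal_mult prod_nonneg mult_ac)
qed

lemma weight_condition_iff:
  assumes "\<B> \<subseteq> rectangles"
  shows "weight_condition \<B> \<alpha> ps p q \<nu> \<omega> \<longleftrightarrow> (\<exists>A\<ge>0. \<forall>R\<in>\<B>. W R \<le> ennreal A)"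
proof -
  have "weight_condition \<B> \<alpha> ps p q \<nu> \<omega> \<longleftrightarrow> (SUP R\<in>\<B>. W R) < \<infinity>"
    unfolding weight_condition_def using assms W_eq by (simp add: subset_iff cong: SUP_cong_simp)
  also have "\<dots> \<longleftrightarrow> (\<exists>A\<ge>0. \<forall>R\<in>\<B>. W R \<le> ennreal A)"
  proof
    assume "(SUP R\<in>\<B>. W R) < \<infinity>"
    then obtain A where A: "0 \<le> A" "(SUP R\<in>\<B>. W R) = ennreal A"
      by (cases "SUP R\<in>\<B>. W R" rule: ennreal_cases) auto
    have "\<forall>R\<in>\<B>. W R \<le> ennreal A" unfolding A(2)[symmetric] by (auto intro: SUP_upper)
    then show "\<exists>A\<ge>0. \<forall>R\<in>\<B>. W R \<le> ennreal A" using A(1) by blast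
  next
    assume "\<exists>A\<ge>0. \<forall>R\<in>\<B>. W R \<le> ennreal A"
    then obtain A where "\<forall>R\<in>\<B>. W R \<le> ennreal A" by blast
    then have "(SUP R\<in>\<B>. W R) \<le> ennreal A" by (intro SUP_least) auto
    then show "(SUP R\<in>\<B>. W R) < \<infinity>" by (rule le_less_trans) simp
  qed
  finally show ?thesis .
qed

lemma frac_term:
  assumes R: "R \<in> rectangles"
  shows "(\<Prod>i\<in>(UNIV::'m set). (\<integral>\<^sup>+y\<in>R. ennreal \<bar>f i y\<bar> \<partial>lebesgue) / ennreal (vol R powr (1 - \<alpha> / (real CARD('m) * real CARD('n)))))
    = ennreal (vol R powr (- (\<beta> * real CARD('m)))) * (\<Prod>i\<in>UNIV. \<integral>\<^sup>+y\<in>R. ennreal \<bar>f i y\<bar> \<partial>lebesgue)"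
proof -
  let ?v = "vol R"
  have v: "0 < ?v" by (rule rectangle_measurable(2)[OF R])
  have "(\<Prod>i\<in>(UNIV::'m set). (\<integral>\<^sup>+y\<in>R. ennreal \<bar>f i y\<bar> \<partial>lebesgue) / ennreal (?v powr \<beta>))
    = (\<Prod>i\<in>(UNIV::'m set). ennreal (?v powr (- \<beta>)) * (\<integral>\<^sup>+y\<in>R. ennreal \<bar>f i y\<bar> \<partial>lebesgue))"
    using v by (intro prod.cong refl) (simp add: divide_ennreal_def inverse_ennreal powr_minus mult.commute)
  also have "\<dots> = ennreal (?v powr (- \<beta>)) ^ CARD('m) * (\<Prod>i\<in>UNIV. \<integral>\<^sup>+y\<in>R. ennreal \<bar>f i y\<bar> \<partial>lebesgue)"
    by (simp add: prod.distrib)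
  also have "ennreal (?v powr (- \<beta>)) ^ CARD('m) = ennreal (?v powr (- (\<beta> * real CARD('m))))"
    using v by (simp add: ennreal_power powr_power mult.commute)
  finally show ?thesis by (simp add: \<beta>_def)
qed

text \<open>
The test functions are the dual weights restricted to \<open>R\<close>. For them
\<open>|f i| powr ps i * \<omega> i = \<sigma> i\<close> on \<open>R\<close>, up to the null set on which \<open>\<sigma> i\<close> is infinite, and on \<open>R\<close> the
maximal function is at least the single term that belongs to \<open>R\<close>.
\<close>

lemma weak_type_imp_weight_condition:
  assumes B: "\<B> \<subseteq> rectangles" and weak: "weak_type_bound \<B> \<alpha> ps q \<nu> \<omega>"
  shows "weight_condition \<B> \<alpha> ps p q \<nu> \<omega>"
proof -
  obtain C :: real where C: "\<forall>f :: 'm \<Rightarrow> real ^ 'n \<Rightarrow> real. (\<forall>i. locally_integrable (f i)) \<longrightarrow>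
        weak_Lp_norm q \<nu> (frac_max \<B> \<alpha> f)
          \<le> ennreal C * (\<Prod>i\<in>UNIV. Lp_norm (ps i) (\<omega> i) (\<lambda>x. ennreal \<bar>f i x\<bar>))"
    using weak unfolding weak_type_bound_def by (elim exE)
  have "W R \<le> ennreal (2 * max C 0)" if RB: "R \<in> \<B>" for R
  proof -
    have R: "R \<in> rectangles" using B RB by auto
    note Rm = rectangle_measurable[OF R]
    define \<sigma> where "\<sigma> i = dual (\<omega> i) (ps i)" for i
    define f where "f i x = enn2real (\<sigma> i x) * indicator R x" for i x
    have sm: "\<sigma> i \<in> borel_measurable lebesgue" for i
      using rd[of i] by (simp add: dyadic_reverse_doubling_def \<sigma>_def)
    have fm: "f i \<in> borel_measurable lebesgue" for i
      unfolding f_def using sm[of i] Rm(1) by measurable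
    have f_le: "ennreal \<bar>f i x\<bar> \<le> \<sigma> i x" for i x
      by (cases "x \<in> R"; cases "\<sigma> i x" rule: ennreal_cases) (auto simp: f_def)
    have li: "locally_integrable (f i)" for i
      unfolding locally_integrable_def
    proof (intro allI impI)
      fix K :: "(real ^ 'n) set" assume K: "compact K"
      then have Km: "K \<in> sets lebesgue" by (simp add: lmeasurable_compact fmeasurableD)
      have "(\<integral>\<^sup>+x. ennreal (norm (indicat_real K x *\<^sub>R f i x)) \<partial>lebesgue) \<le> (\<integral>\<^sup>+x\<in>K. \<sigma> i x \<partial>lebesgue)"
        using f_le[of i] by (intro nn_integral_mono) (auto simp: indicator_def)
      also have "\<dots> < \<infinity>" using rd[of i] K by (simp add: dyadic_reverse_doubling_def \<sigma>_def)
      finally show "f i absolutely_integrable_on K"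
        unfolding set_integrable_def using fm[of i] Km by (intro integrableI_bounded) auto
    qed
    have Fs: "(\<integral>\<^sup>+x\<in>R. ennreal \<bar>f i x\<bar> \<partial>lebesgue) = ennreal (s i R)" for i
    proof -
      have "(\<integral>\<^sup>+x\<in>R. \<sigma> i x \<partial>lebesgue) = ennreal (s i R)" using s_eq[OF R] by (simp add: \<sigma>_def)
      moreover have "(\<integral>\<^sup>+x\<in>R. ennreal \<bar>f i x\<bar> \<partial>lebesgue) = (\<integral>\<^sup>+x\<in>R. \<sigma> i x \<partial>lebesgue)"
      proof (rule nn_integral_cong_AE)
        have "AE x in lebesgue. \<sigma> i x * indicator R x \<noteq> \<infinity>"
          using sm[of i] Rm(1) \<open>(\<integral>\<^sup>+x\<in>R. \<sigma> i x \<partial>lebesgue) = ennreal (s i R)\<close> by (intro nn_integral_PInf_AE) auto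
        then show "AE x in lebesgue. ennreal \<bar>f i x\<bar> * indicator R x = \<sigma> i x * indicator R x"
          by eventually_elim (auto simp: f_def indicator_def less_top split: if_splits)
      qed
      ultimately show ?thesis by simp
    qed
    define l where "l = vol R powr (- (\<beta> * real CARD('m))) * (\<Prod>i\<in>UNIV. s i R)"
    have l: "0 < l" unfolding l_def using Rm(2) s_pos[OF R] by (intro mult_pos_pos prod_pos) auto
    \<comment> \<open>the level is halved because the level sets are defined by a strict inequality\<close>
    have big: "ennreal (l / 2) < frac_max \<B> \<alpha> f x" if "x \<in> R" for x
    proof -
      have "ennreal (l / 2) < ennreal l" using l by (simp add: ennreal_less_iff)
      also have "ennreal l = ennreal (vol R powr (- (\<beta> * real CARD('m)))) * (\<Prod>i\<in>UNIV. \<integral>\<^sup>+y\<in>R. ennreal \<bar>f i y\<bar> \<partial>lebesgue)"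
        unfolding Fs l_def using s_pos[OF R] by (simp add: prod_ennreal ennreal_mult prod_nonneg less_imp_le)
      also have "\<dots> \<le> frac_max \<B> \<alpha> f x"
        unfolding frac_max_def frac_term[OF R, symmetric] using RB that by (intro SUP_upper) auto
      finally show ?thesis .
    qed
    have Lp: "Lp_norm (ps i) (\<omega> i) (\<lambda>x. ennreal \<bar>f i x\<bar>) \<le> ennreal (s i R powr (1 / ps i))" for i
    proof -
      have "(\<integral>\<^sup>+x. (ennreal \<bar>f i x\<bar> epowr ps i) * ennreal (\<omega> i x) \<partial>lebesgue) \<le> (\<integral>\<^sup>+x\<in>R. \<sigma> i x \<partial>lebesgue)"
      proof (intro nn_integral_mono)
        fix x
        show "(ennreal \<bar>f i x\<bar> epowr ps i) * ennreal (\<omega> i x) \<le> \<sigma> i x * indicator R x"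
        proof (cases "x \<in> R \<and> 0 < \<omega> i x")
          case False
          then show ?thesis using ps[of i] by (auto simp: f_def ennreal_neg)
        next
          case True
          let ?r = "conj_exp (ps i)"
          have "(1 - ?r) * ps i + 1 = 1 - ?r" using ps[of i] by (simp add: conj_exp_def field_simps)
          note e = this
          have "(\<omega> i x powr (1 - ?r)) powr ps i * \<omega> i x = \<omega> i x powr ((1 - ?r) * ps i) * \<omega> i x powr 1"
            using True unfolding powr_powr by simp
          also have "\<dots> = \<omega> i x powr (1 - ?r)" unfolding powr_add[symmetric] e ..
          finally have "(\<omega> i x powr (1 - ?r)) powr ps i * \<omega> i x = \<omega> i x powr (1 - ?r)" .
          then show ?thesis using True ps[of i]
            by (simp add: f_def \<sigma>_def epowr_ennreal_pos epowr_ennreal flip: ennreal_mult)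
        qed
      qed
      then have "Lp_norm (ps i) (\<omega> i) (\<lambda>x. ennreal \<bar>f i x\<bar>) \<le> ennreal (s i R) epowr (1 / ps i)"
        unfolding Lp_norm_def using s_eq[OF R] ps[of i] by (intro epowr_mono) (auto simp: \<sigma>_def)
      then show ?thesis using ps[of i] by (simp add: epowr_ennreal)
    qed
    have "ennreal (l / 2) * V R epowr (1 / q)
        \<le> ennreal (l / 2) * (\<integral>\<^sup>+x\<in>{x. frac_max \<B> \<alpha> f x > ennreal (l / 2)}. ennreal (\<nu> x) \<partial>lebesgue) epowr (1 / q)"
      using big q by (intro mult_left_mono epowr_mono nn_integral_mono) (auto simp: indicator_def)
    also have "\<dots> \<le> weak_Lp_norm q \<nu> (frac_max \<B> \<alpha> f)"
      unfolding weak_Lp_norm_def using l by (intro SUP_upper) auto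
    also have "\<dots> \<le> ennreal C * (\<Prod>i\<in>UNIV. Lp_norm (ps i) (\<omega> i) (\<lambda>x. ennreal \<bar>f i x\<bar>))"
      by (intro C[rule_format] li)
    also have "\<dots> \<le> ennreal (max C 0) * (\<Prod>i\<in>UNIV. ennreal (s i R powr (1 / ps i)))"
      by (intro mult_mono prod_mono_ennreal Lp ennreal_leI) auto
    finally have main: "ennreal (l / 2) * V R epowr (1 / q) \<le> ennreal (max C 0) * ennreal (\<Prod>i\<in>UNIV. s i R powr (1 / ps i))"
      by (simp add: prod_ennreal)
    define P where "P = (\<Prod>i\<in>UNIV. s i R powr (- 1 / ps i))"
    have P0: "0 \<le> P" unfolding P_def by (intro prod_nonneg) auto
    have P1: "(\<Prod>i\<in>UNIV. s i R) * P = (\<Prod>i\<in>UNIV. s i R powr (1 / conj_exp (ps i)))"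
      unfolding P_def prod.distrib[symmetric]
    proof (intro prod.cong refl)
      fix i
      have "s i R powr 1 * s i R powr (- 1 / ps i) = s i R powr (1 / conj_exp (ps i))"
        unfolding powr_add[symmetric] conj_exp_facts(4)[OF ps] by simp
      then show "s i R * s i R powr (- 1 / ps i) = s i R powr (1 / conj_exp (ps i))"
        using s_pos[OF R, of i] by simp
    qed
    have P2: "P * (\<Prod>i\<in>UNIV. s i R powr (1 / ps i)) = 1"
      unfolding P_def prod.distrib[symmetric]
    proof (intro prod.neutral ballI)
      fix i
      show "s i R powr (- 1 / ps i) * s i R powr (1 / ps i) = 1"
        unfolding powr_add[symmetric] using s_pos[OF R, of i] by simp
    qed
    have "W R = ennreal (2 * P) * (ennreal (l / 2) * V R epowr (1 / q))"
    proof -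
      have "vol R powr (- (\<beta> * real CARD('m))) * (\<Prod>i\<in>UNIV. s i R powr (1 / conj_exp (ps i))) = (2 * P) * (l / 2)"
        unfolding P1[symmetric] l_def by simp
      then show ?thesis unfolding W_def using P0 l by (simp only: ennreal_mult' mult.assoc)
    qed
    also have "\<dots> \<le> ennreal (2 * P) * (ennreal (max C 0) * ennreal (\<Prod>i\<in>UNIV. s i R powr (1 / ps i)))"
      using main by (rule mult_left_mono) simp
    also have "\<dots> = ennreal (2 * max C 0 * (P * (\<Prod>i\<in>UNIV. s i R powr (1 / ps i))))"
      using P0 by (simp add: ennreal_mult prod_nonneg mult_ac)
    finally show ?thesis by (simp add: P2)
  qed
  then show ?thesis
    unfolding weight_condition_iff[OF B] by (intro exI[of _ "2 * max C 0"]) auto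
qed

end

section \<open>Sufficiency of the weight condition\<close>

context two_weight_setting
begin

text \<open>
The supremum over \<open>\<B>\<close> is replaced by a sum over dyadic boxes, with \<open>dilate C Q\<close> in the
role of the rectangle. The weight condition at \<open>dilate C Q\<close> then removes \<open>\<nu>\<close> and the volume, and the
remaining sum of products is separated into its \<open>m\<close> factors with the exponents \<open>qi i\<close>, whose
reciprocals add up to \<open>1/q\<close>.
\<close>

lemma weight_condition_imp_strong_type:
  fixes C :: "('n \<Rightarrow> int) set"
  assumes B: "\<B> \<subseteq> rectangles" and C: "finite C" "(\<lambda>_. 0) \<in> C" and dilate: "\<And>Q. dilate C Q \<in> \<B>"
    and L: "0 < L"
    and encl: "\<And>R x. R \<in> \<B> \<Longrightarrow> x \<in> R \<Longrightarrow> \<exists>Q. x \<in> dbox Q \<and> R \<subseteq> dilate C Q \<and> vol (dilate C Q) \<le> L * vol R"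
    and W: "weight_condition \<B> \<alpha> ps p q \<nu> \<omega>"
  shows "strong_type_bound \<B> \<alpha> ps q \<nu> \<omega>"
proof -
  have dilateR: "dilate C Q \<in> rectangles" for Q by (rule subsetD[OF B dilate])
  let ?e = "\<beta> * real CARD('m)"
  have e0: "0 < ?e" using beta by simp
  obtain A where A0: "0 \<le> A" and A: "\<And>R. R \<in> \<B> \<Longrightarrow> W R \<le> ennreal A"
    using W unfolding weight_condition_iff[OF B] by metis
  define qi where "qi i = q * ps i / p" for i
  have qi: "ps i < qi i" "0 < qi i" for i
  proof -
    have "ps i * 1 < ps i * (q / p)" using ps[of i] p pq by (intro mult_strict_left_mono) auto
    then show "ps i < qi i" by (simp add: qi_def mult.commute)
    then show "0 < qi i" using ps[of i] by simp
  qed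
  have qi_sum: "(\<Sum>i\<in>UNIV. q / qi i) = 1"
  proof -
    have "(\<Sum>i\<in>UNIV. q / qi i) = p * (\<Sum>i\<in>UNIV. 1 / ps i)"
      unfolding sum_distrib_left using q by (intro sum.cong) (auto simp: qi_def)
    then show ?thesis using p by (simp add: p_sum[symmetric])
  qed
  have "\<forall>i. \<exists>K\<ge>0. \<forall>f I. locally_integrable f \<longrightarrow> finite I \<longrightarrow>
    ennreal (\<Sum>Q\<in>I. (abs_integral f (dilate C Q) / s i (dilate C Q) powr (1 / conj_exp (ps i))) powr qi i)
      \<le> ennreal K * (\<integral>\<^sup>+x. (ennreal \<bar>f x\<bar> epowr ps i) * ennreal (\<omega> i x) \<partial>lebesgue) epowr (qi i / ps i)"
    using dilated_carleson[OF ps qi(1) omega rd C(1) dilateR] by (intro allI)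
  then obtain K where K: "\<forall>i. 0 \<le> K i \<and> (\<forall>f I. locally_integrable f \<longrightarrow> finite I \<longrightarrow>
    ennreal (\<Sum>Q\<in>I. (abs_integral f (dilate C Q) / s i (dilate C Q) powr (1 / conj_exp (ps i))) powr qi i)
      \<le> ennreal (K i) * (\<integral>\<^sup>+x. (ennreal \<bar>f x\<bar> epowr ps i) * ennreal (\<omega> i x) \<partial>lebesgue) epowr (qi i / ps i))"
    by (rule choice[THEN exE])
  define Lc where "Lc = L powr ?e"
  have Lc: "0 < Lc" using L by (simp add: Lc_def)
  define k where "k i = K i powr (q / qi i)" for i
  have k0: "0 \<le> k i" for i by (simp add: k_def)
  define c where "c = (Lc * A) powr q * (\<Prod>i\<in>UNIV. k i)"
  have c0: "0 \<le> c" unfolding c_def using k0 by (intro mult_nonneg_nonneg prod_nonneg) auto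
  have "Lp_norm q \<nu> (frac_max \<B> \<alpha> f) \<le> ennreal (c powr (1 / q)) * (\<Prod>i\<in>UNIV. Lp_norm (ps i) (\<omega> i) (\<lambda>x. ennreal \<bar>f i x\<bar>))"
    if f: "\<forall>i. locally_integrable (f i)" for f :: "'m \<Rightarrow> real ^ 'n \<Rightarrow> real"
  proof -
    define G where "G i = (\<integral>\<^sup>+x. (ennreal \<bar>f i x\<bar> epowr ps i) * ennreal (\<omega> i x) \<partial>lebesgue)" for i
    define \<phi> where "\<phi> i Q = abs_integral (f i) (dilate C Q)" for i Q
    have phi0: "0 \<le> \<phi> i Q" for i Q by (simp add: \<phi>_def)
    define a where "a i Q = \<phi> i Q / s i (dilate C Q) powr (1 / conj_exp (ps i))" for i Q
    have a0: "0 \<le> a i Q" for i Q by (simp add: a_def phi0)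
    define t where "t Q = vol (dilate C Q) powr (- ?e) * (\<Prod>i\<in>UNIV. \<phi> i Q)" for Q
    have t0: "0 \<le> t Q" for Q unfolding t_def using phi0 by (intro mult_nonneg_nonneg prod_nonneg) auto
    have F: "(\<integral>\<^sup>+x\<in>dilate C Q. ennreal \<bar>f i x\<bar> \<partial>lebesgue) = ennreal (\<phi> i Q)" for i Q
      using locally_integrable_finite[OF f[rule_format] dilateR] by (simp add: less_top \<phi>_def)
    \<comment> \<open>an exhaustion of the countable index set by finite sets\<close>
    define I where "I N = {Q :: ('n \<Rightarrow> int) \<times> ('n \<Rightarrow> int). to_nat Q < N}" for N
    have Ifin: "finite (I N)" for N
      using finite_vimageI[OF finite_lessThan[of N] inj_to_nat] by (simp add: I_def vimage_def)
    define T where "T N x = (\<Sum>Q\<in>I N. ennreal ((Lc * t Q) powr q) * indicator (dbox Q) x)" for N and x :: "real ^ 'n"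
    have [measurable]: "dbox Q \<in> sets lebesgue" for Q :: "('n \<Rightarrow> int) \<times> ('n \<Rightarrow> int)"
      by (rule rectangle_measurable(1)[OF dbox_in_rectangles])
    have num [measurable]: "\<nu> \<in> borel_measurable lebesgue" using nu by (simp add: weight_def)
    have point: "frac_max \<B> \<alpha> f x epowr q \<le> (SUP N. T N x)" for x
    proof -
      have "frac_max \<B> \<alpha> f x \<le> (SUP N. T N x) epowr (1 / q)"
        unfolding frac_max_def
      proof (rule SUP_least)
        fix R assume "R \<in> {R \<in> \<B>. x \<in> R}"
        then have R: "R \<in> \<B>" "x \<in> R" by auto
        then have RR: "R \<in> rectangles" using B by auto
        obtain Q where Q: "x \<in> dbox Q" "R \<subseteq> dilate C Q" "vol (dilate C Q) \<le> L * vol R"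
          using encl[OF R] by (elim exE conjE)
        let ?D = "dilate C Q"
        have v: "0 < vol R" "0 < vol ?D" using rectangle_measurable(2)[OF RR] rectangle_measurable(2)[OF dilateR[of Q]] by simp_all
        have "vol R powr (- ?e) \<le> (vol ?D / L) powr (- ?e)"
          using v Q(3) L e0 by (intro powr_mono2') (auto simp: field_simps)
        also have "\<dots> = Lc * vol ?D powr (- ?e)"
          using v L by (simp add: Lc_def powr_divide powr_minus_divide)
        finally have "ennreal (vol R powr (- ?e)) * (\<Prod>i\<in>UNIV. \<integral>\<^sup>+y\<in>R. ennreal \<bar>f i y\<bar> \<partial>lebesgue)
            \<le> ennreal (Lc * vol ?D powr (- ?e)) * (\<Prod>i\<in>UNIV. \<integral>\<^sup>+y\<in>?D. ennreal \<bar>f i y\<bar> \<partial>lebesgue)"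
          using Q(2) by (intro mult_mono prod_mono_ennreal nn_integral_mono ennreal_leI) (auto simp: indicator_def)
        also have "\<dots> = ennreal (Lc * t Q)"
        proof -
          have "0 \<le> Lc * vol ?D powr (- ?e)" using Lc by simp
          moreover have "Lc * t Q = (Lc * vol ?D powr (- ?e)) * (\<Prod>i\<in>UNIV. \<phi> i Q)"
            by (simp only: t_def mult.assoc)
          moreover have "(\<Prod>i\<in>UNIV. ennreal (\<phi> i Q)) = ennreal (\<Prod>i\<in>UNIV. \<phi> i Q)"
            by (intro prod_ennreal phi0)
          ultimately show ?thesis unfolding F by (simp only: ennreal_mult')
        qed
        also have "\<dots> = ennreal ((Lc * t Q) powr q) epowr (1 / q)"
          using Lc t0 q by (simp add: epowr_ennreal powr_powr)
        also have "\<dots> \<le> (SUP N. T N x) epowr (1 / q)"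
        proof (intro epowr_mono)
          have "ennreal ((Lc * t Q) powr q) = ennreal ((Lc * t Q) powr q) * indicator (dbox Q) x" using Q(1) by simp
          also have "\<dots> \<le> T (Suc (to_nat Q)) x"
            unfolding T_def using Ifin by (intro member_le_sum) (auto simp: I_def)
          also have "\<dots> \<le> (SUP N. T N x)" by (rule SUP_upper) simp
          finally show "ennreal ((Lc * t Q) powr q) \<le> (SUP N. T N x)" .
        qed (use q in simp)
        finally show "(\<Prod>i\<in>UNIV. (\<integral>\<^sup>+y\<in>R. ennreal \<bar>f i y\<bar> \<partial>lebesgue) / ennreal (vol R powr (1 - \<alpha> / (real CARD('m) * real CARD('n)))))
            \<le> (SUP N. T N x) epowr (1 / q)"
          unfolding frac_term[OF RR] .
      qed
      then have "frac_max \<B> \<alpha> f x epowr q \<le> ((SUP N. T N x) epowr (1 / q)) epowr q"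
        using q by (rule epowr_mono)
      then show ?thesis using q by (simp add: epowr_epowr)
    qed
    have "(\<integral>\<^sup>+x. (frac_max \<B> \<alpha> f x epowr q) * ennreal (\<nu> x) \<partial>lebesgue) \<le> (\<integral>\<^sup>+x. (SUP N. T N x * ennreal (\<nu> x)) \<partial>lebesgue)"
      using point by (intro nn_integral_mono) (simp add: SUP_mult_right_ennreal[symmetric] mult_right_mono)
    also have "\<dots> = (SUP N. \<integral>\<^sup>+x. T N x * ennreal (\<nu> x) \<partial>lebesgue)"
    proof (rule nn_integral_monotone_convergence_SUP)
      show "incseq (\<lambda>N x. T N x * ennreal (\<nu> x))"
        unfolding incseq_def le_fun_def T_def using Ifin
        by (intro allI impI mult_right_mono sum_mono2) (auto simp: I_def)
      show "(\<lambda>x. T N x * ennreal (\<nu> x)) \<in> borel_measurable lebesgue" for N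
        unfolding T_def by measurable
    qed
    also have "\<dots> \<le> ennreal ((Lc * A) powr q) * (\<Prod>i\<in>UNIV. ennreal (k i) * G i epowr (q / ps i))"
    proof (rule SUP_least)
      fix N
      have "(\<integral>\<^sup>+x. T N x * ennreal (\<nu> x) \<partial>lebesgue)
          = (\<integral>\<^sup>+x. (\<Sum>Q\<in>I N. ennreal ((Lc * t Q) powr q) * (ennreal (\<nu> x) * indicator (dbox Q) x)) \<partial>lebesgue)"
        unfolding T_def sum_distrib_right by (intro nn_integral_cong sum.cong refl) (simp add: mult_ac)
      also have "\<dots> = (\<Sum>Q\<in>I N. ennreal ((Lc * t Q) powr q) * V (dbox Q))"
        by (subst nn_integral_sum) (auto intro!: sum.cong nn_integral_cmult)
      also have "\<dots> \<le> (\<Sum>Q\<in>I N. ennreal ((Lc * A) powr q * (\<Prod>i\<in>UNIV. a i Q powr q)))"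
      proof (intro sum_mono)
        fix Q
        let ?D = "dilate C Q"
        have sp: "0 < s i ?D" for i by (rule s_pos[OF dilateR])
        have "V (dbox Q) \<le> V ?D"
          using C(2) by (intro nn_integral_mono) (auto simp: dilate_def shift_def indicator_def intro!: bexI[of _ "\<lambda>_. 0"])
        then have "ennreal (t Q) * V (dbox Q) epowr (1 / q) \<le> ennreal (t Q) * V ?D epowr (1 / q)"
          using q by (intro mult_left_mono epowr_mono) auto
        also have "\<dots> = ennreal (\<Prod>i\<in>UNIV. a i Q) * W ?D"
        proof -
          have "t Q = (\<Prod>i\<in>UNIV. a i Q) * (vol ?D powr (- ?e) * (\<Prod>i\<in>UNIV. s i ?D powr (1 / conj_exp (ps i))))"
          proof -
            have "(\<Prod>i\<in>UNIV. a i Q) * (\<Prod>i\<in>UNIV. s i ?D powr (1 / conj_exp (ps i))) = (\<Prod>i\<in>UNIV. \<phi> i Q)"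
              unfolding prod.distrib[symmetric] a_def
            proof (intro prod.cong refl)
              fix i
              show "\<phi> i Q / s i ?D powr (1 / conj_exp (ps i)) * s i ?D powr (1 / conj_exp (ps i)) = \<phi> i Q"
                using sp[of i] by simp
            qed
            then show ?thesis by (simp add: t_def)
          qed
          then show ?thesis unfolding W_def
            using a0 by (simp add: ennreal_mult prod_nonneg mult.assoc)
        qed
        also have "\<dots> \<le> ennreal (\<Prod>i\<in>UNIV. a i Q) * ennreal A"
          by (intro mult_left_mono A dilate) simp
        finally have "(ennreal (t Q) * V (dbox Q) epowr (1 / q)) epowr q \<le> (ennreal (\<Prod>i\<in>UNIV. a i Q) * ennreal A) epowr q"
          using q by (rule epowr_mono)
        then have main: "ennreal (t Q powr q) * V (dbox Q) \<le> ennreal ((\<Prod>i\<in>UNIV. a i Q powr q) * A powr q)"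
          using q t0 a0 A0
          by (simp add: epowr_mult epowr_ennreal epowr_epowr prod_nonneg prod_powr_distrib ennreal_mult)
        have "ennreal ((Lc * t Q) powr q) * V (dbox Q) = ennreal (Lc powr q) * (ennreal (t Q powr q) * V (dbox Q))"
          using Lc t0 by (simp add: powr_mult ennreal_mult mult.assoc)
        also have "\<dots> \<le> ennreal (Lc powr q) * ennreal ((\<Prod>i\<in>UNIV. a i Q powr q) * A powr q)"
          by (intro mult_left_mono main) simp
        also have "\<dots> = ennreal ((Lc * A) powr q * (\<Prod>i\<in>UNIV. a i Q powr q))"
          using Lc A0 by (subst ennreal_mult'[symmetric]) (simp_all add: powr_mult mult_ac)
        finally show "ennreal ((Lc * t Q) powr q) * V (dbox Q) \<le> ennreal ((Lc * A) powr q * (\<Prod>i\<in>UNIV. a i Q powr q))" .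
      qed
      also have "\<dots> = ennreal ((Lc * A) powr q) * ennreal (\<Sum>Q\<in>I N. \<Prod>i\<in>UNIV. a i Q powr q)"
        by (subst sum_ennreal) (auto simp: prod_nonneg sum_nonneg sum_distrib_left simp flip: ennreal_mult)
      also have "\<dots> \<le> ennreal ((Lc * A) powr q) * ennreal (\<Prod>i\<in>UNIV. (\<Sum>Q\<in>I N. a i Q powr qi i) powr (q / qi i))"
        using q qi(2) a0 by (intro mult_left_mono ennreal_leI multilinear_Hoelder_sum Ifin qi_sum) auto
      also have "ennreal (\<Prod>i\<in>UNIV. (\<Sum>Q\<in>I N. a i Q powr qi i) powr (q / qi i))
          = (\<Prod>i\<in>UNIV. ennreal (\<Sum>Q\<in>I N. a i Q powr qi i) epowr (q / qi i))"
        using q qi(2) by (simp add: epowr_ennreal sum_nonneg prod_ennreal)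
      also have "ennreal ((Lc * A) powr q) * \<dots> \<le> ennreal ((Lc * A) powr q) * (\<Prod>i\<in>UNIV. ennreal (k i) * G i epowr (q / ps i))"
      proof (intro mult_left_mono prod_mono_ennreal)
        fix i
        have "ennreal (\<Sum>Q\<in>I N. a i Q powr qi i) \<le> ennreal (K i) * G i epowr (qi i / ps i)"
          unfolding a_def G_def \<phi>_def using K[rule_format, of i] f[rule_format, of i] Ifin by simp
        then have "ennreal (\<Sum>Q\<in>I N. a i Q powr qi i) epowr (q / qi i) \<le> (ennreal (K i) * G i epowr (qi i / ps i)) epowr (q / qi i)"
          using q qi(2) by (intro epowr_mono) auto
        also have "\<dots> = ennreal (k i) * G i epowr (q / ps i)"
        proof -
          have "qi i / ps i * (q / qi i) = q / ps i" using qi(2)[of i] by simp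
          moreover have "0 < qi i / ps i" "0 < q / qi i" using qi(2)[of i] q ps[of i] by auto
          moreover have "0 \<le> K i" using K by blast
          ultimately show ?thesis by (simp add: epowr_mult epowr_epowr epowr_ennreal k_def)
        qed
        finally show "ennreal (\<Sum>Q\<in>I N. a i Q powr qi i) epowr (q / qi i) \<le> ennreal (k i) * G i epowr (q / ps i)" .
      qed simp
      finally show "(\<integral>\<^sup>+x. T N x * ennreal (\<nu> x) \<partial>lebesgue)
          \<le> ennreal ((Lc * A) powr q) * (\<Prod>i\<in>UNIV. ennreal (k i) * G i epowr (q / ps i))" .
    qed
    also have "\<dots> = ennreal c * (\<Prod>i\<in>UNIV. G i epowr (q / ps i))"
      using k0 by (simp add: prod.distrib prod_ennreal c_def ennreal_mult prod_nonneg mult.assoc)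
    finally have "Lp_norm q \<nu> (frac_max \<B> \<alpha> f) \<le> (ennreal c * (\<Prod>i\<in>UNIV. G i epowr (q / ps i))) epowr (1 / q)"
      unfolding Lp_norm_def using q by (intro epowr_mono) auto
    also have "\<dots> = ennreal (c powr (1 / q)) * (\<Prod>i\<in>UNIV. (G i epowr (q / ps i)) epowr (1 / q))"
      using q c0 by (simp add: epowr_mult epowr_prod epowr_ennreal)
    also have "(\<Prod>i\<in>UNIV. (G i epowr (q / ps i)) epowr (1 / q)) = (\<Prod>i\<in>UNIV. Lp_norm (ps i) (\<omega> i) (\<lambda>x. ennreal \<bar>f i x\<bar>))"
    proof (intro prod.cong refl)
      fix i
      have "0 < q / ps i" "0 < 1 / q" "q / ps i * (1 / q) = 1 / ps i" using q ps[of i] by auto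
      then show "(G i epowr (q / ps i)) epowr (1 / q) = Lp_norm (ps i) (\<omega> i) (\<lambda>x. ennreal \<bar>f i x\<bar>)"
        by (simp only: epowr_epowr Lp_norm_def G_def)
    qed
    finally show ?thesis .
  qed
  then show ?thesis unfolding strong_type_bound_def by (intro exI[of _ "c powr (1 / q)"]) simp
qed

lemma dyadic_weight_condition_imp_strong_type:
  "weight_condition dyadic_rectangles \<alpha> ps p q \<nu> \<omega> \<Longrightarrow> strong_type_bound dyadic_rectangles \<alpha> ps q \<nu> \<omega>"
proof (rule weight_condition_imp_strong_type[where C = "{\<lambda>_. 0}" and L = 1])
  have *: "dilate {\<lambda>_. 0} Q = dbox Q" for Q :: "('n \<Rightarrow> int) \<times> ('n \<Rightarrow> int)" by (simp add: dilate_def shift_def)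
  show "(dyadic_rectangles :: (real ^ 'n) set set) \<subseteq> rectangles" by (auto simp: dyadic_rectangles_eq dbox_in_rectangles)
  show "dilate {\<lambda>_. 0} Q \<in> dyadic_rectangles" for Q :: "('n \<Rightarrow> int) \<times> ('n \<Rightarrow> int)" by (simp add: * dyadic_rectangles_eq)
  fix R and x :: "real ^ 'n" assume "R \<in> dyadic_rectangles" "x \<in> R"
  then obtain Q where "R = dbox Q" "x \<in> dbox Q" by (auto simp: dyadic_rectangles_eq)
  then show "\<exists>Q. x \<in> dbox Q \<and> R \<subseteq> dilate {\<lambda>_. 0} Q \<and> vol (dilate {\<lambda>_. 0} Q) \<le> 1 * vol R"
    by (intro exI[of _ Q]) (simp add: *)
qed auto

end

definition unit_shifts :: "('n::finite \<Rightarrow> int) set" where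
  "unit_shifts = {c. \<forall>i. c i \<in> {-1, 0, 1}}"

lemma finite_unit_shifts: "finite (unit_shifts :: ('n::finite \<Rightarrow> int) set)"
proof -
  have "(unit_shifts :: ('n \<Rightarrow> int) set) = PiE UNIV (\<lambda>_. {-1, 0, 1})" by (auto simp: unit_shifts_def PiE_def Pi_def)
  then show ?thesis by (metis finite_PiE finite_code finite.intros)
qed

lemma mem_dilate_unit_shifts_iff:
  "x \<in> dilate unit_shifts Q \<longleftrightarrow> (\<forall>i. x $ i \<in> {2 powi fst Q i * of_int (snd Q i - 1) ..< 2 powi fst Q i * of_int (snd Q i + 2)})"
proof -
  let ?fl = "\<lambda>i. \<lfloor>x $ i / 2 powi fst Q i\<rfloor>"
  have "x \<in> dilate unit_shifts Q \<longleftrightarrow> (\<exists>c\<in>unit_shifts. \<forall>i. ?fl i = snd Q i + c i)"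
    by (simp add: dilate_def shift_def mem_dbox_iff)
  also have "\<dots> \<longleftrightarrow> (\<forall>i. ?fl i - snd Q i \<in> {-1, 0, 1})"
  proof
    assume "\<forall>i. ?fl i - snd Q i \<in> {-1, 0, 1}"
    then show "\<exists>c\<in>unit_shifts. \<forall>i. ?fl i = snd Q i + c i"
      by (intro bexI[of _ "\<lambda>i. ?fl i - snd Q i"]) (auto simp: unit_shifts_def)
  qed (auto simp: unit_shifts_def)
  also have "\<dots> \<longleftrightarrow> (\<forall>i. x $ i \<in> {2 powi fst Q i * of_int (snd Q i - 1) ..< 2 powi fst Q i * of_int (snd Q i + 2)})"
  proof (intro iff_allI)
    fix i
    have "?fl i - snd Q i \<in> {-1, 0, 1} \<longleftrightarrow> snd Q i - 1 \<le> ?fl i \<and> ?fl i < snd Q i + 2" by auto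
    also have "\<dots> \<longleftrightarrow> of_int (snd Q i - 1) \<le> x $ i / 2 powi fst Q i \<and> x $ i / 2 powi fst Q i < of_int (snd Q i + 2)"
      by (simp only: le_floor_iff floor_less_iff)
    also have "\<dots> \<longleftrightarrow> x $ i \<in> {2 powi fst Q i * of_int (snd Q i - 1) ..< 2 powi fst Q i * of_int (snd Q i + 2)}"
      by (simp add: pos_le_divide_eq pos_divide_less_eq mult.commute)
    finally show "?fl i - snd Q i \<in> {-1, 0, 1} \<longleftrightarrow> x $ i \<in> {2 powi fst Q i * of_int (snd Q i - 1) ..< 2 powi fst Q i * of_int (snd Q i + 2)}" .
  qed
  finally show ?thesis .
qed

lemma dilate_unit_shifts_rectangle:
  fixes Q :: "('n::finite \<Rightarrow> int) \<times> ('n \<Rightarrow> int)"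
  shows "dilate unit_shifts Q \<in> rectangles" "vol (dilate unit_shifts Q) = (\<Prod>i\<in>UNIV. 3 * 2 powi fst Q i)"
proof -
  let ?l = "\<lambda>i. 2 powi fst Q i * of_int (snd Q i - 1) :: real" and ?u = "\<lambda>i. 2 powi fst Q i * of_int (snd Q i + 2) :: real"
  have eq: "dilate unit_shifts Q = {x. \<forall>i. x $ i \<in> {?l i ..< ?u i}}" by (simp add: set_eq_iff mem_dilate_unit_shifts_iff del: atLeastLessThan_iff)
  have lu: "?u i - ?l i = 3 * 2 powi fst Q i" for i by (simp add: algebra_simps)
  have pos: "0 < (2::real) powi fst Q i" for i by simp
  have "\<exists>a\<in>{?l k ..< ?u k}. \<exists>b\<in>{?l k ..< ?u k}. a < b" for k
  proof -
    have m1: "?l k \<in> {?l k ..< ?u k}" and m2: "?l k + 2 powi fst Q k \<in> {?l k ..< ?u k}"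
      unfolding atLeastLessThan_iff using lu[of k] pos[of k] by linarith+
    moreover have "?l k < ?l k + 2 powi fst Q k" by simp
    ultimately show ?thesis by blast
  qed
  then show R: "dilate unit_shifts Q \<in> rectangles"
    unfolding rectangles_def eq by (intro CollectI exI[of _ "\<lambda>i. {?l i ..< ?u i}"]) (simp add: is_interval_co)
  have "vol (dilate unit_shifts Q) = (\<Prod>k\<in>UNIV. (\<chi> i. ?u i) $ k - (\<chi> i. ?l i) $ k)"
  proof (intro rectangle_measure)
    show "dilate unit_shifts Q \<in> sets borel" using rectangle_bounds[OF R] by metis
    show "(\<chi> i. ?l i) $ k \<le> (\<chi> i. ?u i) $ k" for k using lu[of k] pos[of k] by (simp del: of_int_diff of_int_add)
  qed (auto simp: eq mem_box_cart less_imp_le)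
  then show "vol (dilate unit_shifts Q) = (\<Prod>i\<in>UNIV. 3 * 2 powi fst Q i)" by (simp only: lu vec_lambda_beta)
qed

text \<open>
The side lengths of \<open>R\<close> are rounded up to powers of \<open>2\<close>, at most doubling them; no point of \<open>R\<close>
is then farther from \<open>x\<close>, in any coordinate, than one side length of the dyadic box around \<open>x\<close>.
The volume grows by at most the factor \<open>(3 * 2)\<^sup>n\<close>.
\<close>

lemma rectangle_in_tripled_dyadic:
  fixes x :: "real ^ 'n"
  assumes R: "R \<in> rectangles" and x: "x \<in> R"
  shows "\<exists>Q. x \<in> dbox Q \<and> R \<subseteq> dilate unit_shifts Q \<and> vol (dilate unit_shifts Q) \<le> 6 ^ CARD('n) * vol R"
proof -
  obtain a b :: "real ^ 'n" where ab: "\<And>k. a $ k < b $ k" "box a b \<subseteq> R" "R \<subseteq> cbox a b" "R \<in> sets borel"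
    using rectangle_bounds[OF R] by metis
  define l where "l i = b $ i - a $ i" for i
  have l: "0 < l i" for i using ab(1) by (simp add: l_def)
  define j where "j i = \<lceil>log 2 (l i)\<rceil>" for i
  have j: "l i \<le> 2 powi j i" "2 powi j i \<le> 2 * l i" for i
  proof -
    have e: "2 powi j i = 2 powr real_of_int (j i)" by (simp add: powr_real_of_int')
    have "log 2 (l i) \<le> real_of_int (j i)" by (simp add: j_def)
    then have "2 powr log 2 (l i) \<le> 2 powr real_of_int (j i)" by (intro powr_mono) auto
    then show "l i \<le> 2 powi j i" using l[of i] by (simp add: e)
    have "real_of_int (j i) \<le> 1 + log 2 (l i)" unfolding j_def by linarith
    then have "2 powr real_of_int (j i) \<le> 2 powr (1 + log 2 (l i))" by (intro powr_mono) auto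
    then show "2 powi j i \<le> 2 * l i" using l[of i] by (simp add: e powr_add)
  qed
  define Q where "Q = (j, \<lambda>i. \<lfloor>x $ i / 2 powi j i\<rfloor>)"
  have xQ: "x \<in> dbox Q" by (simp add: Q_def mem_dbox_iff)
  have "R \<subseteq> dilate unit_shifts Q"
  proof
    fix y assume y: "y \<in> R"
    show "y \<in> dilate unit_shifts Q" unfolding mem_dilate_unit_shifts_iff
    proof
      fix i
      have xi: "2 powi j i * of_int (snd Q i) \<le> x $ i" "x $ i < 2 powi j i * of_int (snd Q i + 1)"
        using xQ by (auto simp: dbox_def Q_def)
      have "a $ i \<le> x $ i" "x $ i \<le> b $ i" "a $ i \<le> y $ i" "y $ i \<le> b $ i"
        using subsetD[OF ab(3) x] subsetD[OF ab(3) y] by (simp_all add: mem_box_cart)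
      then have "x $ i - 2 powi j i \<le> y $ i" "y $ i \<le> x $ i + 2 powi j i"
        using j(1)[of i] unfolding l_def by linarith+
      then show "y $ i \<in> {2 powi fst Q i * of_int (snd Q i - 1) ..< 2 powi fst Q i * of_int (snd Q i + 2)}"
        using xi by (simp add: Q_def algebra_simps)
    qed
  qed
  moreover have "vol (dilate unit_shifts Q) \<le> 6 ^ CARD('n) * vol R"
  proof -
    have "vol (dilate unit_shifts Q) = (\<Prod>i\<in>UNIV. 3 * 2 powi j i)" by (simp add: dilate_unit_shifts_rectangle Q_def)
    also have "\<dots> \<le> (\<Prod>i\<in>UNIV. 6 * l i)" using j(2) by (intro prod_mono) (auto simp: mult.commute)
    also have "\<dots> = 6 ^ CARD('n) * vol R"
      using rectangle_measure[OF ab(4) less_imp_le[OF ab(1)] ab(2,3), folded l_def] by (simp add: prod.distrib)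
    finally show ?thesis .
  qed
  ultimately show ?thesis using xQ by blast
qed

theorem theorem2p1:
  fixes \<alpha> p q :: real
    and ps :: "'m::finite \<Rightarrow> real"
    and \<nu> :: "real ^ 'n \<Rightarrow> real"
    and \<omega> :: "'m \<Rightarrow> real ^ 'n \<Rightarrow> real"
  assumes "0 < \<alpha>" and "\<alpha> < real CARD('m) * real CARD('n)"
    and "\<And>i. 1 < ps i"
    and "1 / p = (\<Sum>i\<in>UNIV. 1 / ps i)"
    and "0 < p" and "p < q"
    and "weight \<nu>"
    and "\<And>i. weight (\<omega> i)"
    and "\<And>i. dyadic_reverse_doubling (\<lambda>x. ennreal (\<omega> i x) epowr (1 - conj_exp (ps i)))"
  shows "(weight_condition rectangles \<alpha> ps p q \<nu> \<omega> \<longleftrightarrow>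
            weak_type_bound rectangles \<alpha> ps q \<nu> \<omega>) \<and>
         (weight_condition rectangles \<alpha> ps p q \<nu> \<omega> \<longleftrightarrow>
            strong_type_bound rectangles \<alpha> ps q \<nu> \<omega>) \<and>
         (weight_condition dyadic_rectangles \<alpha> ps p q \<nu> \<omega> \<longleftrightarrow>
            weak_type_bound dyadic_rectangles \<alpha> ps q \<nu> \<omega>) \<and>
         (weight_condition dyadic_rectangles \<alpha> ps p q \<nu> \<omega> \<longleftrightarrow>
            strong_type_bound dyadic_rectangles \<alpha> ps q \<nu> \<omega>)"
proof -
  interpret two_weight_setting \<alpha> p q ps \<nu> \<omega>
    using assms by (intro two_weight_setting.intro)
  have D: "(dyadic_rectangles :: (real ^ 'n) set set) \<subseteq> rectangles"
    by (auto simp: dyadic_rectangles_eq dbox_in_rectangles)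
  have "strong_type_bound rectangles \<alpha> ps q \<nu> \<omega>" if "weight_condition rectangles \<alpha> ps p q \<nu> \<omega>"
  proof (rule weight_condition_imp_strong_type[OF order_refl finite_unit_shifts])
    show "(\<lambda>_. 0) \<in> unit_shifts" by (simp add: unit_shifts_def)
    show "0 < (6::real) ^ CARD('n)" by simp
    show "dilate unit_shifts Q \<in> rectangles" for Q :: "('n \<Rightarrow> int) \<times> ('n \<Rightarrow> int)" by (rule dilate_unit_shifts_rectangle)
    show "\<exists>Q. x \<in> dbox Q \<and> R \<subseteq> dilate unit_shifts Q \<and> vol (dilate unit_shifts Q) \<le> 6 ^ CARD('n) * vol R"
      if "R \<in> rectangles" "x \<in> R" for R and x :: "real ^ 'n"
      by (rule rectangle_in_tripled_dyadic[OF that])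
  qed fact
  then show ?thesis
    using dyadic_weight_condition_imp_strong_type strong_imp_weak[OF q] weak_type_imp_weight_condition[OF D]
      weak_type_imp_weight_condition[OF order_refl] by blast
qed

end
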